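(* Let $p$ be an odd prime, and let $n$ be a positive integer with $2\mid n$ and $p-1\nmid n$. Then $$\frac{2\sum_{k=1}^n\binom{pn-1}{pk-1}(-1)^k}{(-p)^{\lfloor(n-2)/(p-1)\rfloor}p^{n+1}n}=\frac{F_p(pn,0)}{pn}\equiv\frac{n_*!}{n_*+1}B_{p-1-n_*}\pmod p.$$ Moreover, for any positive integers $b,m$ with $b>2\lfloor (pn-1)/(p-1)\rfloor$, $$\frac{2}{pn}\cdot\frac{(pn-1)!\,S(m\varphi(p^b),pn-1)}{(-p)^{\lfloor(pn-2)/(p-1)\rfloor}}\equiv-\frac{(pn-1)!\,S(m\varphi(p^b),pn)}{(-p)^{\lfloor(pn-1)/(p-1)\rfloor}}\equiv\frac{n_*!}{n_*+1}B_{p-1-n_*}\pmod p.$$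
   Context: For $n\in\mathbb{N}$, $r\in\mathbb{Z}$: $C_p(n,r)=\sum_{k\equiv r\,(\mathrm{mod}\ p)}\binom nk(-1)^k$ and $F_p(n,r)=(-p)^{-\lfloor (n-1)/(p-1)\rfloor}C_p(n,r)+[\![n=0]\!]$ ($[\![A]\!]$ is $1$ if $A$ holds, else $0$). $n_*$ is the smallest positive residue of $n$ modulo $p-1$. $B_k$ are the Bernoulli numbers ($x/(e^x-1)=\sum_k B_kx^k/k!$). $S(m,n)$ is the Stirling number of the second kind (number of partitions of an $m$-set into $n$ nonempty blocks), and $\varphi$ is Euler's totient function. Congruences between rationals modulo $p$ mean the difference divided by $p$ is a $p$-adic integer. *)

theory Defs
  imports
    "HOL-Computational_Algebra.Formal_Power_Series"
    "HOL-Combinatorics.Stirling"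
    "HOL-Number_Theory.Number_Theory"
begin

definition bernoulli :: "nat \<Rightarrow> rat"
  where "bernoulli k = fact k * fps_nth (fps_X / (fps_exp 1 - 1)) k"

text \<open>
  A rational number is a \<open>p\<close>-adic integer iff \<open>p\<close> does not divide the
  denominator of its reduced fraction.
\<close>

definition padic_integral :: "nat \<Rightarrow> rat \<Rightarrow> bool"
  where "padic_integral p x \<longleftrightarrow> \<not> int p dvd snd (quotient_of x)"

definition rat_cong :: "rat \<Rightarrow> rat \<Rightarrow> nat \<Rightarrow> bool"
  where "rat_cong x y p \<longleftrightarrow> padic_integral p ((x - y) / of_nat p)"

text \<open>The terms with \<open>k > n\<close> vanish, so the sum is restricted to \<open>k \<le> n\<close>.\<close>

definition C :: "nat \<Rightarrow> nat \<Rightarrow> int \<Rightarrow> int"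
  where "C p n r = (\<Sum>k | k \<le> n \<and> [int k = r] (mod int p). of_nat (n choose k) * (- 1) ^ k)"

text \<open>
  Since \<open>div\<close> on \<^typ>\<open>int\<close> rounds towards minus infinity, the exponent is the floor of
  \<open>(n - 1) / (p - 1)\<close> also for \<open>n = 0\<close>, where it equals \<open>-1\<close>.
\<close>

definition F :: "nat \<Rightarrow> nat \<Rightarrow> int \<Rightarrow> rat"
  where "F p n r =
    (- of_nat p) powi (- ((int n - 1) div (int p - 1))) * of_int (C p n r) + of_bool (n = 0)"

definition pos_residue :: "nat \<Rightarrow> nat \<Rightarrow> nat"
  where "pos_residue p n = (LEAST r. 0 < r \<and> [r = n] (mod (p - 1)))"

end

theory Submission
  imports Defs "HOL-Computational_Algebra.Polynomial_FPS"
begin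

unbundle fps_syntax

text \<open>
  Iterating Pascal's rule \<open>C p (N+1) r = C p N r - C p N (r-1)\<close> over the residues shows that
  \<open>\<Sum>\<^sub>N C p N 0 t^N = (1-t)^(p-1) / (t^p + (1-t)^p)\<close>. Writing \<open>t^p + (1-t)^p = 1 - p g(t)\<close>
  and taking the logarithmic derivative gives
  \<open>C p N 0 / N = \<Sum>\<^sub>i p^(i-1)/i [t^N] g^i\<close>. The polynomial \<open>g\<close> has degree \<open>p - 1\<close>, so for
  \<open>N = p n\<close> the sum starts at \<open>i = e + 1\<close> with \<open>e = \<lfloor>(pn-1)/(p-1)\<rfloor>\<close>, and all later terms vanish
  modulo \<open>p^(e+1)\<close>. In the first term, the reversal \<open>h\<close> of \<open>g\<close> is congruent to \<open>ln(1-s)/s\<close>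
  modulo \<open>p\<close> up to degree \<open>p - 2\<close>, and \<open>h^(pl) \<equiv> (-1)^l\<close> modulo \<open>(p, s^p)\<close> replaces the power
  \<open>h^(e+1)\<close> by \<open>\<plusminus> h^(-k)\<close> with \<open>k = p - 1 - n\<^sub>*\<close>. Lagrange inversion evaluates
  \<open>[s^k] (s/ln(1-s))^k = B\<^sub>k / k!\<close>, and Wilson's theorem rewrites the result as stated.
  For the Stirling numbers, Euler's theorem turns
  \<open>N! S(m\<phi>(p^b), N) = \<Sum>\<^sub>k (-1)^(N-k) binom(N,k) k^(m\<phi>(p^b))\<close> into a sum over \<open>k\<close> prime to \<open>p\<close>, which is \<open>-(-1)^N C p N 0\<close> modulo \<open>p^b\<close>.
\<close>

subsection \<open>The generating function of alternating binomial sums\<close>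

lemma C_eq_sum: "C p n r = (\<Sum>k\<le>n. of_bool ([int k = r] (mod int p)) * (of_nat (n choose k) * (- 1) ^ k))"
proof -
  have "C p n r = (\<Sum>k\<in>{k\<in>{..n}. [int k = r] (mod int p)}. of_nat (n choose k) * (- 1) ^ k)"
    unfolding C_def by (intro sum.cong) auto
  also have "\<dots> = (\<Sum>k\<le>n. if [int k = r] (mod int p) then of_nat (n choose k) * (- 1) ^ k else 0)"
    by (subst sum.inter_filter) auto
  also have "\<dots> = (\<Sum>k\<le>n. of_bool ([int k = r] (mod int p)) * (of_nat (n choose k) * (- 1) ^ k))"
    by (intro sum.cong) auto
  finally show ?thesis .
qed

lemma C_0: "C p 0 r = of_bool ([0 = r] (mod int p))"
  by (simp add: C_eq_sum)

lemma C_cong: "[r = s] (mod int p) \<Longrightarrow> C p n r = C p n s"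
  unfolding C_eq_sum by (intro sum.cong) (auto simp: cong_def)

lemma C_Suc: "C p (Suc n) r = C p n r - C p n (r - 1)"
proof -
  define w where "w k = (of_bool ([int k = r] (mod int p)) :: int)" for k
  have shift: "of_bool ([int k = r - 1] (mod int p)) = w (Suc k)" for k
  proof -
    have "[int k = r - 1] (mod int p) \<longleftrightarrow> [int (Suc k) = r] (mod int p)"
      by (simp add: cong_iff_dvd_diff algebra_simps)
    thus ?thesis by (simp add: w_def)
  qed
  have "C p (Suc n) r = w 0 + (\<Sum>k\<le>n. w (Suc k) * (of_nat (Suc n choose Suc k) * (- 1) ^ Suc k))"
    unfolding C_eq_sum w_def[symmetric] by (subst sum.atMost_Suc_shift) simp
  also have "\<dots> = (w 0 + (\<Sum>k\<le>n. w (Suc k) * (of_nat (n choose Suc k) * (- 1) ^ Suc k)))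
       - (\<Sum>k\<le>n. w (Suc k) * (of_nat (n choose k) * (- 1) ^ k))"
    by (simp add: algebra_simps sum.distrib sum_negf sum_subtractf)
  also have "w 0 + (\<Sum>k\<le>n. w (Suc k) * (of_nat (n choose Suc k) * (- 1) ^ Suc k)) =
      (\<Sum>k\<le>Suc n. w k * (of_nat (n choose k) * (- 1) ^ k))"
    by (subst sum.atMost_Suc_shift) simp
  also have "\<dots> = C p n r" by (simp add: C_eq_sum w_def)
  also have "(\<Sum>k\<le>n. w (Suc k) * (of_nat (n choose k) * (- 1) ^ k)) = C p n (r - 1)"
    by (simp add: C_eq_sum shift)
  finally show ?thesis .
qed

text \<open>Since \<open>C p 0 r\<close> vanishes for \<open>0 < r < p\<close>, Pascal's rule
  reduces \<open>G j\<close> to \<open>G 0\<close> for every \<open>j < p\<close>. Going once around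
  the residues returns to \<open>G 0\<close> and leaves a linear equation for it.\<close>

lemma C_gen_fun:
  assumes "p > 0"
  shows "Abs_fps (\<lambda>n. C p n 0) * ((1 - fps_X) ^ p - (- fps_X) ^ p) = (1 - fps_X) ^ (p - 1)"
proof -
  define G where "G r = Abs_fps (\<lambda>n. C p n r)" for r
  have step: "(1 - fps_X) * G r = fps_const (C p 0 r) - fps_X * G (r - 1)" for r
  proof (rule fps_ext)
    fix n show "((1 - fps_X) * G r) $ n = (fps_const (C p 0 r) - fps_X * G (r - 1)) $ n"
      by (cases n) (simp_all add: G_def C_Suc algebra_simps)
  qed
  have pow: "(1 - fps_X) ^ j * G (int j) = (- fps_X) ^ j * G 0" if "j < p" for j
    using that
  proof (induction j)
    case (Suc j)
    have "\<not> int p dvd int (Suc j)" using Suc.prems by (auto dest: zdvd_imp_le)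
    hence C0: "C p 0 (int (Suc j)) = 0"
      unfolding C_0 by (subst cong_sym_eq) (simp add: cong_iff_dvd_diff)
    have "(1 - fps_X) ^ Suc j * G (int (Suc j)) = (1 - fps_X) ^ j * ((1 - fps_X) * G (int (Suc j)))"
      by (simp add: algebra_simps)
    also have "(1 - fps_X) * G (int (Suc j)) = - fps_X * G (int j)"
      using step[of "int (Suc j)"] C0 by simp
    also have "(1 - fps_X) ^ j * (- fps_X * G (int j)) = - fps_X * ((1 - fps_X) ^ j * G (int j))"
      by (simp add: algebra_simps)
    also have "\<dots> = (- fps_X) ^ Suc j * G 0"
      using Suc by (simp add: algebra_simps)
    finally show ?case .
  qed auto
  \<comment> \<open>The residues \<open>-1\<close> and \<open>p - 1\<close> coincide modulo
    \<open>p\<close>; this closes the cycle.\<close>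
  have "G (0 - 1) = G (int (p - 1))"
    unfolding G_def by (intro arg_cong[of _ _ Abs_fps] ext C_cong) (use assms in \<open>auto simp: cong_iff_dvd_diff of_nat_diff\<close>)
  hence "(1 - fps_X) * G 0 = 1 - fps_X * G (int (p - 1))"
    using step[of 0] by (simp add: C_0)
  hence "(1 - fps_X) ^ (p - 1) * ((1 - fps_X) * G 0) =
      (1 - fps_X) ^ (p - 1) * (1 - fps_X * G (int (p - 1)))"
    by (rule arg_cong)
  also have "\<dots> = (1 - fps_X) ^ (p - 1) - fps_X * ((1 - fps_X) ^ (p - 1) * G (int (p - 1)))"
    by (simp add: algebra_simps)
  also have "\<dots> = (1 - fps_X) ^ (p - 1) - fps_X * ((- fps_X) ^ (p - 1) * G 0)"
    using pow[of "p - 1"] assms by simp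
  finally have "(1 - fps_X) ^ Suc (p - 1) * G 0 = (1 - fps_X) ^ (p - 1) + (- fps_X) ^ Suc (p - 1) * G 0"
    by (simp add: algebra_simps)
  thus ?thesis using assms by (simp add: G_def algebra_simps)
qed

text \<open>For an odd prime \<open>p\<close> this is \<open>(1 - X^p - (1 - X)^p) / p\<close>. The
  division is done on each binomial coefficient, where it is exact, so the polynomial stays
  integral.\<close>

definition g_poly :: "nat \<Rightarrow> int poly"
  where "g_poly p = (\<Sum>j = 1..<p. monom ((- 1) ^ Suc j * int ((p choose j) div p)) j)"

lemma coeff_g_poly:
  "coeff (g_poly p) j = (if 1 \<le> j \<and> j < p then (- 1) ^ Suc j * int ((p choose j) div p) else 0)"
proof -
  have "coeff (g_poly p) j = (\<Sum>i\<in>{1..<p}. if j = i then (- 1) ^ Suc j * int ((p choose j) div p) else 0)"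
    unfolding g_poly_def coeff_sum coeff_monom by (intro sum.cong) auto
  thus ?thesis by simp
qed

text \<open>The inner binomial coefficients are divisible by \<open>p\<close>. In degree
  \<open>p\<close> the terms \<open>- X^p\<close> and \<open>- (- X)^p\<close> cancel because
  \<open>p\<close> is odd.\<close>

lemma g_poly_eq:
  assumes "prime p" "odd p"
  shows "fps_of_poly (g_poly p) * of_nat p = 1 - fps_X ^ p - (1 - fps_X) ^ p"
proof (rule fps_ext)
  fix j
  have "[:1, - 1 :: int:] = [:1:] - [:0, 1:]" by simp
  hence "fps_of_poly [:1, - 1 :: int:] = 1 - fps_X"
    by (simp only: fps_of_poly_diff fps_of_poly_fps_X fps_of_poly_1')
  hence "(1 - fps_X :: int fps) ^ p $ j = coeff ([:1, -1:] ^ p) j"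
    by (metis fps_of_poly_nth fps_of_poly_power)
  also have "\<dots> = int (p choose j) * (- 1) ^ j"
    by (cases "j \<le> p") (simp_all add: coeff_linear_poly_power coeff_eq_0 degree_linear_power binomial_eq_0)
  finally have pw: "(1 - fps_X :: int fps) ^ p $ j = int (p choose j) * (- 1) ^ j" .
  have p: "p > 0" using assms prime_gt_0_nat by blast
  have pc: "int p * int ((p choose j) div p) = int (p choose j)" if "1 \<le> j" "j < p"
  proof -
    have "p dvd (p choose j)" using that assms by (intro dvd_choose_prime) auto
    thus ?thesis by (metis dvd_mult_div_cancel of_nat_mult)
  qed
  consider "j = 0" | "1 \<le> j" "j < p" | "j = p" | "j > p" by linarith
  thus "(fps_of_poly (g_poly p) * of_nat p) $ j = (1 - fps_X ^ p - (1 - fps_X) ^ p :: int fps) $ j"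
    unfolding fps_sub_nth pw
    using p assms(2) pc
    by cases (simp_all add: coeff_g_poly fps_X_power_nth fps_mult_of_nat_nth algebra_simps)
qed

lemma fps_X_dvdI:
  fixes f :: "'a :: comm_ring_1 fps"
  assumes "f $ 0 = 0"
  shows "fps_X dvd f"
proof
  show "f = fps_X * fps_shift 1 f"
    using assms by (intro fps_ext) (simp add: fps_X_mult_nth)
qed

text \<open>With the constant term removed, the generating function is
  \<open>G = X g' / (1 - P g)\<close>. Expanding the geometric series, the \<open>N\<close>-th
  coefficient of \<open>X g' g^(i-1)\<close> is \<open>N/i\<close> times that of \<open>g^i\<close>.
  All series stay over the integers; only coefficients are divided by \<open>i\<close>.\<close>

lemma C_expansion:
  assumes "prime p" "odd p" "N > 0"
  shows "of_int (C p N 0) / of_nat N =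
    (\<Sum>i=1..N. of_nat p ^ (i - 1) / of_nat i * of_int (coeff (g_poly p ^ i) N) :: rat)"
proof -
  define g where "g = fps_of_poly (g_poly p)"
  define G where "G = Abs_fps (\<lambda>n. C p n 0) - 1"
  define P where "P = (of_nat p :: int fps)"
  have p: "p > 0" using assms prime_gt_0_nat by blast
  have geq: "g * P = 1 - fps_X ^ p - (1 - fps_X) ^ p"
    unfolding g_def P_def by (rule g_poly_eq) fact+
  \<comment> \<open>Cancelling \<open>P\<close> in the derivative of \<open>g * P\<close> gives
    \<open>fps_deriv g\<close> without touching the coefficients of \<open>g\<close>.\<close>
  have "P * fps_deriv g = fps_deriv (g * P)" by (simp add: P_def)
  also have "\<dots> = P * ((1 - fps_X) ^ (p - 1) - fps_X ^ (p - 1))"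
    unfolding geq by (simp add: fps_deriv_power' P_def algebra_simps)
  finally have dg: "fps_deriv g = (1 - fps_X) ^ (p - 1) - fps_X ^ (p - 1)"
    using p by (simp add: P_def)
  have "Abs_fps (\<lambda>n. C p n 0) * (1 - g * P) = (1 - fps_X) ^ (p - 1)"
    using C_gen_fun[OF p] assms(2) by (simp add: geq add.commute)
  hence "G * (1 - g * P) = (1 - fps_X) ^ (p - 1) - (1 - g * P)"
    by (simp add: G_def algebra_simps)
  also have "\<dots> = (1 - fps_X) ^ (p - 1) - (1 - fps_X) ^ Suc (p - 1) - fps_X ^ Suc (p - 1)"
    using p by (simp add: geq)
  also have "\<dots> = fps_X * fps_deriv g" by (simp add: dg algebra_simps)
  finally have rec: "G = fps_X * fps_deriv g + g * P * G" by (simp add: algebra_simps)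
  have iter: "G = (\<Sum>j<M. fps_X * fps_deriv g * (g * P) ^ j) + (g * P) ^ M * G" for M
  proof (induction M)
    case (Suc M)
    have "(g * P) ^ M * G = (g * P) ^ M * (fps_X * fps_deriv g + g * P * G)"
      using rec by simp
    thus ?case using Suc by (simp add: algebra_simps)
  qed simp
  \<comment> \<open>Both \<open>g\<close> and \<open>G\<close> have zero constant term, so the
    remainder after \<open>N\<close> iterations has order at least \<open>N + 1\<close>.\<close>
  have "((g * P) ^ N * G) $ N = 0"
  proof -
    have "g $ 0 = 0" by (simp add: g_def coeff_g_poly)
    hence "fps_X dvd g" by (rule fps_X_dvdI)
    moreover have "G $ 0 = 0" by (simp add: G_def C_0)
    hence "fps_X dvd G" by (rule fps_X_dvdI)
    ultimately have "fps_X ^ N * fps_X dvd (g * P) ^ N * G"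
      by (intro mult_dvd_mono dvd_power_same) auto
    then obtain r where "(g * P) ^ N * G = fps_X ^ Suc N * r"
      by (metis dvd_def power_Suc mult.commute)
    thus ?thesis by (simp add: fps_X_power_mult_nth del: power_Suc)
  qed
  hence "G $ N = (\<Sum>j<N. (fps_X * fps_deriv g * (g * P) ^ j) $ N)"
    using arg_cong[OF iter[of N], of "\<lambda>f. f $ N"] by (simp add: fps_sum_nth)
  also have "G $ N = C p N 0" using assms by (simp add: G_def)
  finally have "(of_int (C p N 0) :: rat) = (\<Sum>j<N. of_int ((fps_X * fps_deriv g * (g * P) ^ j) $ N))"
    by simp
  also have "\<dots> = (\<Sum>j<N. of_nat N * (of_nat p ^ j / of_nat (Suc j) * of_int (coeff (g_poly p ^ Suc j) N)))"
  proof (intro sum.cong refl)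
    fix j
    \<comment> \<open>The factor \<open>Suc j\<close> completes the derivative of
      \<open>g ^ Suc j\<close>.\<close>
    have "of_nat (Suc j) * (fps_X * fps_deriv g * (g * P) ^ j) =
        fps_X * P ^ j * (of_nat (Suc j) * fps_deriv g * g ^ (Suc j - 1))"
      by (simp add: power_mult_distrib algebra_simps del: of_nat_Suc)
    also have "\<dots> = P ^ j * (fps_X * fps_deriv (g ^ Suc j))"
      unfolding fps_deriv_power' by (simp add: algebra_simps)
    finally have "(of_nat (Suc j) * (fps_X * fps_deriv g * (g * P) ^ j)) $ N =
        (P ^ j * (fps_X * fps_deriv (g ^ Suc j))) $ N" by (rule arg_cong)
    moreover have "(P ^ j * (fps_X * fps_deriv (g ^ Suc j))) $ N = int p ^ j * (int N * coeff (g_poly p ^ Suc j) N)"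
      using \<open>N > 0\<close> unfolding P_def of_nat_power[symmetric] fps_mult_of_nat_nth
      by (simp add: g_def fps_of_poly_power[symmetric] fps_X_mult_nth of_nat_diff del: power_Suc)
    ultimately have "int (Suc j) * (fps_X * fps_deriv g * (g * P) ^ j) $ N =
        int p ^ j * (int N * coeff (g_poly p ^ Suc j) N)"
      by (simp only: fps_mult_of_nat_nth)
    hence "(of_int (int (Suc j) * (fps_X * fps_deriv g * (g * P) ^ j) $ N) :: rat) =
        of_int (int p ^ j * (int N * coeff (g_poly p ^ Suc j) N))" by (rule arg_cong)
    thus "(of_int ((fps_X * fps_deriv g * (g * P) ^ j) $ N) :: rat) =
      of_nat N * (of_nat p ^ j / of_nat (Suc j) * of_int (coeff (g_poly p ^ Suc j) N))"
      by (simp add: field_simps del: of_nat_Suc power_Suc)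
  qed
  also have "\<dots> = of_nat N * (\<Sum>j<N. of_nat p ^ j / of_nat (Suc j) * of_int (coeff (g_poly p ^ Suc j) N))"
    by (simp add: sum_distrib_left)
  also have "(\<Sum>j<N. of_nat p ^ j / of_nat (Suc j) * of_int (coeff (g_poly p ^ Suc j) N) :: rat) =
     (\<Sum>i=1..N. of_nat p ^ (i - 1) / of_nat i * of_int (coeff (g_poly p ^ i) N))"
    by (rule sum.reindex_bij_witness[of _ "\<lambda>i. i - 1" Suc]) auto
  finally show ?thesis using \<open>N > 0\<close> by (simp add: field_simps)
qed

subsection \<open>Congruences between rationals\<close>

text \<open>The reduced denominator divides every other denominator of the same number, so an
  unreduced fraction serves as a witness. Closure under ring operations then amounts to multiplying
  denominators.\<close>

lemma padic_integral_iff: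
  assumes "prime p"
  shows "padic_integral p x \<longleftrightarrow> (\<exists>a b. x = of_int a / of_int b \<and> \<not> int p dvd b)"
proof
  assume "padic_integral p x"
  thus "\<exists>a b. x = of_int a / of_int b \<and> \<not> int p dvd b"
    unfolding padic_integral_def by (metis prod.collapse quotient_of_div)
next
  assume "\<exists>a b. x = of_int a / of_int b \<and> \<not> int p dvd b"
  then obtain a b where ab: "x = of_int a / of_int b" "\<not> int p dvd b" by blast
  obtain n d where nd: "quotient_of x = (n, d)" by (cases "quotient_of x")
  have "b \<noteq> 0" using ab(2) by auto
  have "d > 0" using quotient_of_denom_pos[OF nd] .
  have "(of_int n / of_int d :: rat) = of_int a / of_int b"
    using quotient_of_div[OF nd] ab(1) by simp
  hence "(of_int (n * b) :: rat) = of_int (a * d)"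
    using \<open>b \<noteq> 0\<close> \<open>d > 0\<close> by (simp add: field_simps)
  hence "n * b = a * d" by (simp only: of_int_eq_iff)
  hence "d dvd n * b" by simp
  hence "d dvd b" using quotient_of_coprime[OF nd]
    by (metis coprime_commute coprime_dvd_mult_right_iff)
  thus "padic_integral p x" using ab(2) nd unfolding padic_integral_def by (auto dest: dvd_trans)
qed

lemma padic_integral_of_int: "prime p \<Longrightarrow> padic_integral p (of_int a)"
  unfolding padic_integral_iff
  by (rule exI[of _ a], rule exI[of _ 1]) (auto dest: prime_gt_1_nat)

lemma padic_integral_of_nat: "prime p \<Longrightarrow> padic_integral p (of_nat a)"
  using padic_integral_of_int[of p "int a"] by simp

lemma padic_integral_add:
  assumes "prime p" "padic_integral p x" "padic_integral p y"
  shows "padic_integral p (x + y)"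
proof -
  obtain a b c d where *: "x = of_int a / of_int b" "\<not> int p dvd b" "y = of_int c / of_int d" "\<not> int p dvd d"
    using assms padic_integral_iff by metis
  have "b \<noteq> 0" "d \<noteq> 0" using * by auto
  hence "x + y = of_int (a * d + c * b) / of_int (b * d)" using * by (simp add: field_simps)
  moreover have "\<not> int p dvd b * d"
    using * assms(1) by (simp add: prime_dvd_mult_iff)
  ultimately show ?thesis using assms(1) padic_integral_iff by blast
qed

lemma padic_integral_mult:
  assumes "prime p" "padic_integral p x" "padic_integral p y"
  shows "padic_integral p (x * y)"
proof -
  obtain a b c d where *: "x = of_int a / of_int b" "\<not> int p dvd b" "y = of_int c / of_int d" "\<not> int p dvd d"
    using assms padic_integral_iff by metis
  have "x * y = of_int (a * c) / of_int (b * d)" using * by simp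
  moreover have "\<not> int p dvd b * d"
    using * assms(1) by (simp add: prime_dvd_mult_iff)
  ultimately show ?thesis using assms(1) padic_integral_iff by blast
qed

lemma padic_integral_minus: "prime p \<Longrightarrow> padic_integral p x \<Longrightarrow> padic_integral p (- x)"
  using padic_integral_mult[of p "-1" x] padic_integral_of_int[of p "-1"] by simp

lemma padic_integral_diff:
  "prime p \<Longrightarrow> padic_integral p x \<Longrightarrow> padic_integral p y \<Longrightarrow> padic_integral p (x - y)"
  using padic_integral_add[of p x "- y"] padic_integral_minus by simp

lemma padic_integral_power: "prime p \<Longrightarrow> padic_integral p x \<Longrightarrow> padic_integral p (x ^ n)"
  by (induction n) (use padic_integral_of_int[of p 1] in \<open>auto intro: padic_integral_mult\<close>)

lemma padic_integral_sum:
  "prime p \<Longrightarrow> (\<And>i. i \<in> A \<Longrightarrow> padic_integral p (f i)) \<Longrightarrow> padic_integral p (sum f A)"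
  by (induction A rule: infinite_finite_induct)
     (use padic_integral_of_int[of p 0] in \<open>auto intro: padic_integral_add\<close>)

lemma padic_integral_inverse_of_int:
  assumes "prime p" "\<not> int p dvd b"
  shows "padic_integral p (1 / of_int b)"
  unfolding padic_integral_iff[OF assms(1)] using assms(2)
  by (intro exI[of _ 1] exI[of _ b]) auto

lemma padic_integral_inverse_of_nat:
  "prime p \<Longrightarrow> \<not> p dvd b \<Longrightarrow> padic_integral p (1 / of_nat b)"
  using padic_integral_inverse_of_int[of p "int b"] by simp

text \<open>The multiplicity of \<open>p\<close> in \<open>d\<close> is at most \<open>v\<close>, so
  \<open>p ^ v\<close> absorbs the whole \<open>p\<close>-part of \<open>d\<close>.\<close>

lemma padic_integral_power_divide:
  assumes "prime p" "\<not> p ^ Suc v dvd d"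
  shows "padic_integral p (of_nat p ^ v / of_nat d)"
proof -
  have "d \<noteq> 0" using assms(2) by (metis dvd_0_right)
  moreover have "\<not> is_unit p" using assms(1) by auto
  ultimately obtain y where y: "d = p ^ multiplicity p d * y" "\<not> p dvd y"
    using multiplicity_decompose'[of d p] by metis
  define u where "u = multiplicity p d"
  have "u \<le> v"
  proof (rule ccontr)
    assume "\<not> u \<le> v"
    hence "p ^ Suc v dvd p ^ u" by (intro le_imp_power_dvd) auto
    also have "p ^ u dvd d" unfolding u_def by (rule multiplicity_dvd)
    finally show False using assms(2) by simp
  qed
  hence "(of_nat p ^ v :: rat) = of_nat p ^ u * of_nat p ^ (v - u)"
    by (simp flip: power_add)
  moreover have "(of_nat d :: rat) = of_nat p ^ u * of_nat y"
    using y(1) by (metis u_def of_nat_mult of_nat_power)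
  moreover have "p > 0" using assms(1) prime_gt_0_nat by blast
  ultimately have "(of_nat p ^ v / of_nat d :: rat) = of_nat p ^ (v - u) * (1 / of_nat y)"
    by simp
  thus ?thesis
    using assms(1) y(2) by (auto intro!: padic_integral_mult padic_integral_power
        padic_integral_of_nat padic_integral_inverse_of_nat simp del: times_divide_eq_right)
qed

lemma rat_cong_refl: "prime p \<Longrightarrow> rat_cong x x p"
  using padic_integral_of_int[of p 0] by (simp add: rat_cong_def)

lemma rat_cong_sym: "prime p \<Longrightarrow> rat_cong x y p \<Longrightarrow> rat_cong y x p"
  using padic_integral_minus[of p "(x - y) / of_nat p"] by (simp add: rat_cong_def minus_divide_left)

lemma rat_cong_trans: "prime p \<Longrightarrow> rat_cong x y p \<Longrightarrow> rat_cong y z p \<Longrightarrow> rat_cong x z p"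
  using padic_integral_add[of p "(x - y) / of_nat p" "(y - z) / of_nat p"]
  by (simp add: rat_cong_def flip: add_divide_distrib)

text \<open>From \<open>x y - x' y' = (x - x') y + x' (y - y')\<close>; this is why
  \<open>x'\<close> and \<open>y\<close> have to be integral.\<close>

lemma rat_cong_mult:
  assumes "prime p" "rat_cong x x' p" "rat_cong y y' p" "padic_integral p x'" "padic_integral p y"
  shows "rat_cong (x * y) (x' * y') p"
proof -
  have "padic_integral p ((x - x') / of_nat p * y + x' * ((y - y') / of_nat p))"
    using assms unfolding rat_cong_def by (intro padic_integral_add padic_integral_mult)
  also have "(x - x') / of_nat p * y + x' * ((y - y') / of_nat p) = (x * y - x' * y') / of_nat p"
    by (simp add: diff_divide_distrib algebra_simps)
  finally show ?thesis by (simp add: rat_cong_def)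
qed

lemma rat_cong_sum:
  assumes "prime p" "\<And>i. i \<in> A \<Longrightarrow> rat_cong (f i) (g i) p"
  shows "rat_cong (sum f A) (sum g A) p"
  using padic_integral_sum[of p A "\<lambda>i. (f i - g i) / of_nat p"] assms
  by (simp add: rat_cong_def sum_subtractf flip: sum_divide_distrib)

lemma rat_cong_of_int:
  assumes "prime p" "[a = b] (mod int p)"
  shows "rat_cong (of_int a) (of_int b) p"
proof -
  obtain c where "a - b = int p * c" using assms(2) by (auto simp: cong_iff_dvd_diff)
  hence "(of_int a - of_int b :: rat) = of_nat p * of_int c"
    by (metis of_int_diff of_int_mult of_int_of_nat_eq)
  thus ?thesis using assms(1) prime_gt_0_nat[OF assms(1)]
    by (simp add: rat_cong_def padic_integral_of_int)
qed

subsection \<open>Stirling numbers\<close>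

text \<open>Absorption, \<open>k binom(n,k) = n (binom(n,k) - binom(n-1,k))\<close>, turns the sum
  \<open>D n\<close> for exponent \<open>m\<close> into \<open>n (D n - D (n-1))\<close> for
  exponent \<open>m + 1\<close>. This is the Stirling recurrence scaled by
  \<open>(-1)^n n!\<close>.\<close>

lemma alternating_binomial_power_sum:
  "(\<Sum>k\<le>n. (- 1) ^ k * int (n choose k) * int k ^ m) = (- 1) ^ n * fact n * int (Stirling m n)"
proof (induction m arbitrary: n)
  case 0
  show ?case
  proof (cases n)
    case (Suc n')
    thus ?thesis using choose_alternating_sum[of n, where 'a = int] by simp
  qed simp
next
  case (Suc m)
  define D where "D n = (\<Sum>k\<le>n. (- 1) ^ k * int (n choose k) * int k ^ m)" for n
  show ?case
  proof (cases n)
    case n: (Suc n')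
    have absorb: "int (Suc n' choose Suc k) * int (Suc k) =
        int (Suc n') * (int (Suc n' choose Suc k) - int (n' choose Suc k))" for k
    proof -
      have "int (Suc n' choose Suc k) * int (Suc k) = int (Suc n' * (n' choose k))"
        by (simp only: Suc_times_binomial mult.commute flip: of_nat_mult)
      also have "\<dots> = int (Suc n') * (int (Suc n' choose Suc k) - int (n' choose Suc k))"
        by (simp add: algebra_simps)
      finally show ?thesis .
    qed
    have "(\<Sum>k\<le>n. (- 1) ^ k * int (n choose k) * int k ^ Suc m) =
        (\<Sum>k\<le>n'. (- 1) ^ Suc k * (int (Suc n' choose Suc k) * int (Suc k)) * int (Suc k) ^ m)"
      unfolding n by (subst sum.atMost_Suc_shift) (simp add: algebra_simps del: binomial_Suc_Suc)
    also have "\<dots> = (\<Sum>k\<le>n'. (- 1) ^ Suc k * (int (Suc n') * (int (Suc n' choose Suc k) - int (n' choose Suc k))) * int (Suc k) ^ m)"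
      by (simp only: absorb)
    also have "\<dots> = int (Suc n') * ((\<Sum>k\<le>n'. (- 1) ^ Suc k * int (Suc n' choose Suc k) * int (Suc k) ^ m)
        - (\<Sum>k\<le>n'. (- 1) ^ Suc k * int (n' choose Suc k) * int (Suc k) ^ m))"
      unfolding sum_subtractf[symmetric] sum_distrib_left
      by (intro sum.cong refl) (simp add: algebra_simps del: binomial_Suc_Suc of_nat_Suc)
    also have "\<dots> = int (Suc n') * ((\<Sum>k\<le>Suc n'. (- 1) ^ k * int (Suc n' choose k) * int k ^ m)
        - (\<Sum>k\<le>Suc n'. (- 1) ^ k * int (n' choose k) * int k ^ m))"
      unfolding sum.atMost_Suc_shift[of _ n'] by simp
    also have "(\<Sum>k\<le>Suc n'. (- 1) ^ k * int (n' choose k) * int k ^ m) = D n'"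
      by (simp add: D_def)
    finally have "(\<Sum>k\<le>n. (- 1) ^ k * int (n choose k) * int k ^ Suc m) = int n * (D n - D n')"
      by (simp add: D_def n)
    also have "\<dots> = (- 1) ^ n * fact n * int (Stirling (Suc m) n)"
      unfolding D_def Suc.IH by (simp add: n algebra_simps)
    finally show ?thesis .
  qed simp
qed

lemma Stirling_totient_cong:
  assumes "prime p" "b > 0" "m > 0" "N > 0"
  shows "[(- 1) ^ N * fact N * int (Stirling (m * totient (p ^ b)) N) = - C p N 0] (mod int p ^ b)"
proof -
  define M where "M = m * totient (p ^ b)"
  have p: "p > 1" using assms prime_gt_1_nat by blast
  \<comment> \<open>This makes \<open>k ^ M\<close> vanish modulo \<open>p ^ b\<close> for multiples
    \<open>k\<close> of \<open>p\<close>.\<close>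
  have "b \<le> M"
  proof -
    have "b \<le> 2 ^ (b - 1)"
      using less_exp[of "b - 1"] assms(2) by linarith
    also have "\<dots> \<le> p ^ (b - 1)" using p by (intro power_mono) auto
    also have "\<dots> \<le> p ^ (b - 1) * (p - 1)" using p by simp
    also have "\<dots> = totient (p ^ b)" using totient_prime_power[OF assms(1,2)] by simp
    also have "\<dots> \<le> M" using assms(3) by (simp add: M_def)
    finally show ?thesis .
  qed
  have pow: "[int k ^ M = 1 - of_bool ([int k = 0] (mod int p))] (mod int p ^ b)" for k
  proof (cases "p dvd k")
    case True
    hence "p ^ b dvd k ^ M"
      using \<open>b \<le> M\<close> by (metis dvd_power_same le_imp_power_dvd dvd_trans)
    hence "int p ^ b dvd int k ^ M" by (metis of_nat_dvd_iff of_nat_power)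
    thus ?thesis using True by (simp add: cong_0_iff)
  next
    case False
    hence "coprime k (p ^ b)"
      using assms(1) by (metis coprime_commute coprime_power_left_iff prime_imp_coprime)
    hence "[k ^ totient (p ^ b) = 1] (mod p ^ b)" by (rule euler_theorem)
    hence "[(k ^ totient (p ^ b)) ^ m = 1 ^ m] (mod p ^ b)" by (rule cong_pow)
    hence "[k ^ M = 1] (mod p ^ b)" by (simp add: M_def mult.commute flip: power_mult)
    hence "[int k ^ M = 1] (mod int p ^ b)"
      by (metis cong_int_iff of_nat_1 of_nat_power)
    thus ?thesis using False by (simp add: cong_0_iff)
  qed
  have "(- 1) ^ N * fact N * int (Stirling M N) = (\<Sum>k\<le>N. (- 1) ^ k * int (N choose k) * int k ^ M)"
    by (simp add: alternating_binomial_power_sum)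
  also have "[\<dots> = (\<Sum>k\<le>N. (- 1) ^ k * int (N choose k) * (1 - of_bool ([int k = 0] (mod int p))))] (mod int p ^ b)"
    by (intro cong_sum cong_mult pow) auto
  also have "(\<Sum>k\<le>N. (- 1) ^ k * int (N choose k) * (1 - of_bool ([int k = 0] (mod int p)))) =
     (\<Sum>k\<le>N. (- 1) ^ k * int (N choose k)) - C p N 0"
    unfolding C_eq_sum sum_subtractf[symmetric]
    by (intro sum.cong refl) (simp add: algebra_simps)
  \<comment> \<open>The unrestricted alternating sum is \<open>(1 - 1)^N\<close>, so only the part
    over multiples of \<open>p\<close> survives, with a minus sign.\<close>
  also have "(\<Sum>k\<le>N. (- 1) ^ k * int (N choose k)) = 0"
    using assms(4) by (rule choose_alternating_sum)
  finally show ?thesis by (simp add: M_def)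
qed

subsection \<open>Lagrange inversion for the logarithm\<close>

text \<open>Change of variables for residues: with \<open>f = X H\<close>, the residues of
  \<open>\<Phi>(f) f' / f^(k+1)\<close> and \<open>\<Phi> / X^(k+1)\<close> agree. Writing
  \<open>1/f\<close> as \<open>inverse H / X\<close> clears the negative powers of
  \<open>X\<close>.\<close>

lemma fps_residue_compose:
  fixes H \<Phi> :: "'a :: field_char_0 fps"
  assumes "H $ 0 \<noteq> 0"
  shows "((\<Phi> oo (fps_X * H)) * fps_deriv (fps_X * H) * inverse H ^ Suc k) $ k = \<Phi> $ k"
proof -
  define f where "f = fps_X * H"
  define U where "U = inverse H"
  have UH: "U * H = 1" using inverse_mult_eq_1[OF assms] by (simp add: U_def)
  have U': "fps_deriv U = - fps_deriv H * U ^ 2"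
    unfolding U_def using assms by (rule fps_inverse_deriv)
  have f': "fps_deriv f = H + fps_X * fps_deriv H" by (simp add: f_def)
  have f0: "f $ 0 = 0" by (simp add: f_def)
  \<comment> \<open>As \<open>f ^ i\<close> has order at least \<open>i\<close>, only finitely many
    terms of the composition reach degree \<open>k\<close>, and linearity reduces the claim to
    monomials.\<close>
  have trunc: "(\<Phi> oo f) $ n = (\<Sum>i\<le>k. fps_const (\<Phi> $ i) * f ^ i) $ n" if "n \<le> k" for n
  proof -
    have "(\<Phi> oo f) $ n = (\<Sum>i\<in>{0..n}. \<Phi> $ i * f ^ i $ n)"
      by (rule fps_compose_nth)
    also have "\<dots> = (\<Sum>i\<in>{..k}. \<Phi> $ i * f ^ i $ n)"
      using that startsby_zero_power_prefix[OF f0] by (intro sum.mono_neutral_left) auto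
    finally show ?thesis by (simp add: fps_sum_nth)
  qed
  \<comment> \<open>This is the residue of \<open>f' / f^(m+1)\<close>. For \<open>m > 0\<close> it
    vanishes because the function is the derivative of \<open>- f^(-m) / m\<close>; below, this
    shows up as a comparison with the derivative of \<open>U ^ m\<close>.\<close>
  have res: "(fps_deriv f * U ^ Suc m) $ m = of_bool (m = 0)" for m
  proof (cases m)
    case 0
    thus ?thesis using UH by (simp add: f') (metis fps_mult_nth_0 fps_one_nth mult.commute)
  next
    case (Suc m')
    have "fps_deriv f * U ^ Suc m = U ^ m * (U * H) + fps_X * (fps_deriv H * U ^ Suc m)"
      by (simp add: f' algebra_simps)
    hence eq: "(fps_deriv f * U ^ Suc m) $ m = U ^ m $ m + (fps_deriv H * U ^ Suc m) $ m'"
      by (simp add: UH Suc del: power_Suc)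
    have "fps_deriv (U ^ m) = of_nat m * fps_deriv U * U ^ (m - 1)" by (rule fps_deriv_power')
    also have "\<dots> = - (of_nat m * (fps_deriv H * U ^ Suc m))"
      unfolding U' by (simp add: Suc power2_eq_square algebra_simps)
    finally have "fps_deriv (U ^ m) $ m' = - (of_nat m * (fps_deriv H * U ^ Suc m)) $ m'" by simp
    hence "of_nat m * (U ^ m $ m) = of_nat m * - ((fps_deriv H * U ^ Suc m) $ m')"
      unfolding fps_deriv_nth fps_neg_nth fps_mult_of_nat_nth using Suc by simp
    moreover have "of_nat m \<noteq> (0 :: 'a)" using Suc by (simp del: of_nat_Suc)
    ultimately have "U ^ m $ m = - ((fps_deriv H * U ^ Suc m) $ m')"
      by (metis mult_left_cancel)
    thus ?thesis unfolding eq using Suc by simp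
  qed
  have "((\<Phi> oo f) * (fps_deriv f * U ^ Suc k)) $ k =
      ((\<Sum>i\<le>k. fps_const (\<Phi> $ i) * f ^ i) * (fps_deriv f * U ^ Suc k)) $ k"
    unfolding fps_mult_nth using trunc by (intro sum.cong) auto
  also have "\<dots> = (\<Sum>i\<le>k. (fps_const (\<Phi> $ i) * (f ^ i * (fps_deriv f * U ^ Suc k))) $ k)"
    by (simp add: sum_distrib_right fps_sum_nth mult.assoc del: fps_mult_left_const_nth power_Suc)
  also have "\<dots> = (\<Sum>i\<le>k. \<Phi> $ i * of_bool (i = k))"
  proof (intro sum.cong refl)
    fix i assume i: "i \<in> {..k}"
    \<comment> \<open>The factor \<open>U ^ i\<close> cancels the \<open>H ^ i\<close> inside
      \<open>f ^ i\<close>, leaving a shift by \<open>X^i\<close>.\<close>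
    have "U ^ Suc k = U ^ i * U ^ Suc (k - i)" using i by (simp flip: power_add)
    hence "f ^ i * (fps_deriv f * U ^ Suc k) = fps_X ^ i * ((U * H) ^ i * (fps_deriv f * U ^ Suc (k - i)))"
      by (simp add: f_def power_mult_distrib algebra_simps del: power_Suc)
    also have "\<dots> $ k = (fps_deriv f * U ^ Suc (k - i)) $ (k - i)"
      using i by (simp add: UH fps_X_power_mult_nth del: power_Suc)
    also have "\<dots> = of_bool (i = k)" using i unfolding res by auto
    finally show "(fps_const (\<Phi> $ i) * (f ^ i * (fps_deriv f * U ^ Suc k))) $ k = \<Phi> $ i * of_bool (i = k)"
      by simp
  qed
  also have "\<dots> = \<Phi> $ k" by simp
  finally show ?thesis by (simp add: f_def U_def mult.assoc)
qed

text \<open>The series \<open>ln(1 - X) / X\<close>.\<close>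

definition log_quot :: "rat fps"
  where "log_quot = Abs_fps (\<lambda>n. - 1 / of_nat (Suc n))"

lemma fps_deriv_log: "fps_deriv (fps_X * log_quot) * (1 - fps_X) = - 1"
proof (rule fps_ext)
  define d where "d = fps_deriv (fps_X * log_quot)"
  have d: "d $ n = - 1" for n
    unfolding d_def fps_deriv_nth by (simp add: log_quot_def del: of_nat_Suc)
  show "(fps_deriv (fps_X * log_quot) * (1 - fps_X)) $ n = (- 1) $ n" for n
    unfolding d_def[symmetric] by (cases n) (simp_all add: algebra_simps d)
qed

text \<open>The composition \<open>y\<close> satisfies \<open>y' (1 - X) = - y\<close>, that is
  \<open>(n+1) y_(n+1) = (n-1) y_n\<close>. With \<open>y_0 = 1\<close> this forces
  \<open>y_1 = -1\<close> and zeros afterwards.\<close>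

lemma fps_exp_compose_log: "fps_exp 1 oo (fps_X * log_quot) = 1 - fps_X"
proof -
  define f where "f = fps_X * log_quot"
  define y where "y = fps_exp 1 oo f"
  have f0: "f $ 0 = 0" by (simp add: f_def)
  have f': "fps_deriv f * (1 - fps_X) = - 1"
  unfolding f_def by (rule fps_deriv_log)
  have "fps_deriv y = y * fps_deriv f"
    unfolding y_def using f0 by (subst fps_compose_deriv) simp_all
  hence "fps_deriv y * (1 - fps_X) = y * (fps_deriv f * (1 - fps_X))" by simp
  hence "fps_deriv y * (1 - fps_X) = - y" by (simp only: f') simp
  hence rec: "(fps_deriv y * (1 - fps_X)) $ n = - (y $ n)" for n by simp
  have y0: "y $ 0 = 1" by (simp add: y_def)
  have y1: "y $ Suc 0 = - 1" using rec[of 0] y0 by simp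
  have y2: "y $ Suc (Suc n) = 0" for n
  proof (induction n)
    case 0
    show ?case using rec[of 1] y1 by (simp add: algebra_simps)
  next
    case (Suc n)
    have "of_nat (Suc (Suc (Suc n))) * y $ Suc (Suc (Suc n)) = 0"
      using rec[of "Suc (Suc n)"] Suc by (simp add: algebra_simps)
    thus ?case by (simp del: of_nat_Suc)
  qed
  have "y = 1 - fps_X"
  proof (rule fps_ext)
    fix n show "y $ n = (1 - fps_X) $ n"
      by (cases n rule: nat.exhaust; (cases "n - 1")?) (use y0 y1 y2 in \<open>simp_all\<close>)
  qed
  thus ?thesis by (simp add: y_def f_def)
qed

text \<open>\<open>\<Phi> = \<beta> exp(X)\<close> is chosen so that
  \<open>(\<Phi> oo f) f' = log_quot\<close> for \<open>f = ln(1 - X)\<close>. The change of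
  variables then gives \<open>\<Phi> $ k\<close>. As \<open>\<Phi> = \<beta> + X\<close>, it agrees
  with the Bernoulli series \<open>\<beta>\<close> in degrees \<open>k \<ge> 2\<close>.\<close>

lemma log_quot_power_nth:
  assumes "k \<ge> 2"
  shows "(inverse log_quot ^ k) $ k = bernoulli k / fact k"
proof -
  define E where "E = (fps_exp 1 - 1 :: rat fps)"
  define \<beta> where "\<beta> = fps_X / E"
  define f where "f = fps_X * log_quot"
  define U where "U = inverse log_quot"
  define \<Phi> where "\<Phi> = \<beta> * (1 + E)"
  have f0: "f $ 0 = 0" by (simp add: f_def)
  have "E $ 1 \<noteq> 0" "E $ 0 = 0" by (simp_all add: E_def)
  hence "subdegree E = 1" by (intro subdegreeI) auto
  moreover have "E \<noteq> 0" using \<open>E $ 1 \<noteq> 0\<close> by auto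
  ultimately have "E dvd fps_X" by (subst fps_dvd_iff) auto
  hence \<beta>E: "\<beta> * E = fps_X" by (simp add: \<beta>_def)
  have EX: "1 + E = fps_exp 1" by (simp add: E_def)
  \<comment> \<open>From \<open>exp(f) = 1 - X\<close>. Composing \<open>\<beta> E = X\<close> with
    \<open>f\<close> therefore determines \<open>\<beta> oo f\<close>.\<close>
  have Ef: "E oo f = - fps_X"
    unfolding E_def fps_compose_sub_distrib f_def fps_exp_compose_log by simp
  have "(\<beta> oo f) * (E oo f) = fps_X oo f"
    unfolding \<beta>E[symmetric] using f0 by (simp add: fps_compose_mult_distrib)
  also have "\<dots> = f" using f0 by (simp add: fps_X_fps_compose_startby0)
  finally have "- fps_X * (\<beta> oo f) = fps_X * log_quot" unfolding Ef by (simp add: f_def mult.commute)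
  hence "fps_X * (- (\<beta> oo f)) = fps_X * log_quot" by simp
  hence \<beta>f: "\<beta> oo f = - log_quot" by (metis fps_X_neq_zero minus_equation_iff mult_left_cancel)
  have "\<Phi> oo f = - (log_quot * (1 - fps_X))"
    using fps_exp_compose_log
    by (simp add: \<Phi>_def EX fps_compose_mult_distrib[OF f0] \<beta>f flip: f_def)
  moreover have "fps_deriv f * (1 - fps_X) = - 1"
  unfolding f_def by (rule fps_deriv_log)
  ultimately have \<Phi>f: "(\<Phi> oo f) * fps_deriv f = log_quot"
    by (metis (no_types, lifting) mult.assoc mult.commute mult_minus_left mult_minus1_right minus_minus)
  have H0: "log_quot $ 0 \<noteq> 0" by (simp add: log_quot_def)
  have UH: "log_quot * U = 1" using inverse_mult_eq_1'[OF H0] by (simp add: U_def)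
  have "U ^ k = (\<Phi> oo f) * fps_deriv f * U ^ Suc k"
    unfolding \<Phi>f using UH by (simp add: mult.assoc[symmetric])
  also have "\<dots> $ k = \<Phi> $ k"
    unfolding f_def U_def by (rule fps_residue_compose[OF H0])
  also have "\<Phi> = fps_X + \<beta>" by (simp add: \<Phi>_def ring_distribs \<beta>E)
  also have "(fps_X + \<beta>) $ k = \<beta> $ k" using assms by simp
  also have "\<beta> $ k = bernoulli k / fact k" by (simp add: bernoulli_def \<beta>_def E_def)
  finally show ?thesis by (simp add: U_def)
qed

subsection \<open>The leading term modulo a prime\<close>

text \<open>Neighbouring coefficients add up to \<open>binom(p, i+1)\<close>, which \<open>p\<close>
  divides, so they alternate in sign modulo \<open>p\<close>.\<close>

lemma binomial_pred_prime_cong: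
  assumes "prime p" "i < p"
  shows "[int ((p - 1) choose i) = (- 1) ^ i] (mod int p)"
  using assms(2)
proof (induction i)
  case (Suc i)
  have "p > 0" using assms by (simp add: prime_gt_0_nat)
  hence "(p choose Suc i) = ((p - 1) choose i) + ((p - 1) choose Suc i)"
    by (metis Suc_diff_1 binomial_Suc_Suc)
  moreover have "p dvd (p choose Suc i)"
    using Suc.prems assms(1) by (intro dvd_choose_prime) auto
  ultimately have "[int ((p - 1) choose i) + int ((p - 1) choose Suc i) = 0] (mod int p)"
    by (metis cong_0_iff of_nat_add of_nat_dvd_iff)
  from cong_diff[OF this Suc.IH] Suc.prems show ?case by simp
qed simp

lemma degree_g_poly:
  assumes "prime p" "odd p"
  shows "degree (g_poly p) = p - 1" "coeff (g_poly p) (p - 1) = - 1"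
proof -
  have p: "p > 1" using assms(1) prime_gt_1_nat by blast
  have "p choose (p - 1) = p"
    using p by (subst binomial_symmetric) auto
  thus lead: "coeff (g_poly p) (p - 1) = - 1"
    using p assms(2) by (auto simp: coeff_g_poly)
  show "degree (g_poly p) = p - 1"
  proof (rule antisym)
    show "degree (g_poly p) \<le> p - 1"
      by (intro degree_le) (auto simp: coeff_g_poly)
    show "p - 1 \<le> degree (g_poly p)"
      using lead by (intro le_degree) simp
  qed
qed

text \<open>For \<open>j = p - 1 - a\<close> and \<open>c\<close> the coefficient of
  \<open>g_poly p\<close> at \<open>j\<close>, absorption gives
  \<open>j c = (-1)^(j+1) binom(p-1, j-1)\<close>, which is \<open>1\<close> modulo
  \<open>p\<close>. Since \<open>j\<close> is congruent to \<open>-(a+1)\<close>, \<open>c\<close>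
  is congruent to \<open>-1/(a+1)\<close>.\<close>

lemma coeff_reflect_g_poly_cong:
  assumes "prime p" "odd p" "a < p - 1"
  shows "rat_cong (of_int (coeff (reflect_poly (g_poly p)) a)) (log_quot $ a) p"
proof -
  define j where "j = p - 1 - a"
  define c where "c = coeff (g_poly p) j"
  define B where "B = (p choose j) div p"
  have j: "1 \<le> j" "j < p" "p = j + Suc a" using assms(3) by (auto simp: j_def)
  have p: "p > 0" using j by simp
  have "p dvd (p choose j)" using j assms(1) by (intro dvd_choose_prime) auto
  hence "p * (j * B) = j * (p choose j)" by (simp add: B_def)
  also have "\<dots> = p * ((p - 1) choose (j - 1))"
    using j by (metis One_nat_def Suc_diff_1 Suc_le_eq Suc_times_binomial mult.commute p)
  finally have jB: "j * B = (p - 1) choose (j - 1)" using p by simp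
  have "c = (- 1) ^ Suc j * int B"
    using j by (simp add: c_def coeff_g_poly B_def)
  hence "int j * c = (- 1) ^ Suc j * int ((p - 1) choose (j - 1))"
    unfolding jB[symmetric] by simp
  hence "[int j * c = (- 1) ^ Suc j * int ((p - 1) choose (j - 1))] (mod int p)" by simp
  also have "[(- 1) ^ Suc j * int ((p - 1) choose (j - 1)) = (- 1) ^ Suc j * (- 1) ^ (j - 1)] (mod int p)"
    using j by (intro cong_mult cong_refl binomial_pred_prime_cong assms) auto
  also have "(- 1) ^ Suc j * (- 1) ^ (j - 1) = (1 :: int)"
    using j by (cases j) (auto simp flip: power_add)
  finally obtain t where "int j * c - 1 = int p * t" by (auto simp: cong_iff_dvd_diff)
  hence eq: "int (Suc a) * c + 1 = int p * (c - t)"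
    using j(3) by (simp add: algebra_simps)
  have "(of_nat (Suc a) * of_int c + 1 :: rat) = of_nat p * of_int (c - t)"
    using arg_cong[OF eq, of "of_int :: int \<Rightarrow> rat"] by simp
  hence "(of_int c - - 1 / of_nat (Suc a) :: rat) / of_nat p = of_int (c - t) * (1 / of_nat (Suc a))"
  proof -
    have "(of_int c - - 1 / of_nat (Suc a) :: rat) = (of_nat (Suc a) * of_int c + 1) / of_nat (Suc a)"
      by (simp add: field_simps del: of_nat_Suc)
    also note \<open>(of_nat (Suc a) * of_int c + 1 :: rat) = of_nat p * of_int (c - t)\<close>
    finally show ?thesis using p by simp
  qed
  moreover have "\<not> p dvd Suc a" using j by (auto dest: dvd_imp_le)
  hence "padic_integral p (of_int (c - t) * (1 / of_nat (Suc a)))"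
    by (intro padic_integral_mult padic_integral_of_int padic_integral_inverse_of_nat assms)
  ultimately have "rat_cong (of_int c) (log_quot $ a) p"
    by (simp add: rat_cong_def log_quot_def)
  thus ?thesis
    using assms by (simp add: coeff_reflect_poly degree_g_poly c_def j_def)
qed

text \<open>Read off from \<open>(h^i)' = i h' h^(i-1)\<close>. It allows a denominator
  \<open>i\<close> to be traded for the degree of the coefficient.\<close>

lemma dvd_coeff_power:
  fixes h :: "int poly"
  shows "int i dvd int (Suc d) * coeff (h ^ i) (Suc d)"
proof -
  have "fps_deriv (fps_of_poly h ^ i) $ d = int i * (fps_deriv (fps_of_poly h) * fps_of_poly h ^ (i - 1)) $ d"
    unfolding fps_deriv_power' mult.assoc by (rule fps_mult_of_nat_nth)
  moreover have "fps_deriv (fps_of_poly h ^ i) $ d = int (Suc d) * coeff (h ^ i) (Suc d)"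
    by (simp add: fps_of_poly_power[symmetric])
  ultimately show ?thesis by (metis dvd_triv_left)
qed

section \<open>Congruences of rational power series below a degree bound\<close>

definition rat_fps :: "int poly \<Rightarrow> rat fps"
  where "rat_fps h = Abs_fps (\<lambda>j. of_int (coeff h j))"

lemma rat_fps_nth [simp]: "rat_fps h $ j = of_int (coeff h j)"
  by (simp add: rat_fps_def)

lemma rat_fps_mult: "rat_fps (g * h) = rat_fps g * rat_fps h"
  by (rule fps_ext) (simp add: coeff_mult fps_mult_nth atLeast0AtMost)

lemma rat_fps_power: "rat_fps (h ^ n) = rat_fps h ^ n"
proof (induction n)
  case 0
  show ?case by (rule fps_ext) (simp add: coeff_1)
qed (simp add: rat_fps_mult)

text \<open>Degrees are bounded because \<open>log_quot\<close> has the coefficient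
  \<open>-1/p\<close> in degree \<open>p - 1\<close>; the bound used below is
  \<open>p - 1\<close>.\<close>

definition fps_integral :: "nat \<Rightarrow> rat fps \<Rightarrow> nat \<Rightarrow> bool"
  where "fps_integral p A n \<longleftrightarrow> (\<forall>j<n. padic_integral p (A $ j))"

definition fps_rat_cong :: "nat \<Rightarrow> rat fps \<Rightarrow> rat fps \<Rightarrow> nat \<Rightarrow> bool"
  where "fps_rat_cong p A B n \<longleftrightarrow> (\<forall>j<n. rat_cong (A $ j) (B $ j) p)"

lemma fps_integral_mult:
  "prime p \<Longrightarrow> fps_integral p A n \<Longrightarrow> fps_integral p B n \<Longrightarrow> fps_integral p (A * B) n"
  unfolding fps_integral_def fps_mult_nth
  by (intro allI impI padic_integral_sum padic_integral_mult) auto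

lemma fps_integral_power:
  "prime p \<Longrightarrow> fps_integral p A n \<Longrightarrow> fps_integral p (A ^ k) n"
proof (induction k)
  case 0
  thus ?case by (auto simp: fps_integral_def padic_integral_of_int[of p 1, simplified]
      padic_integral_of_int[of p 0, simplified] fps_one_def)
qed (simp add: fps_integral_mult)

lemma fps_integral_rat_fps: "prime p \<Longrightarrow> fps_integral p (rat_fps h) n"
  by (simp add: fps_integral_def padic_integral_of_int)

lemma fps_rat_cong_refl: "prime p \<Longrightarrow> fps_rat_cong p A A n"
  by (simp add: fps_rat_cong_def rat_cong_refl)

lemma fps_rat_cong_mult:
  assumes "prime p" "fps_rat_cong p A A' n" "fps_rat_cong p B B' n" "fps_integral p A' n" "fps_integral p B n"
  shows "fps_rat_cong p (A * B) (A' * B') n"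
  using assms unfolding fps_rat_cong_def fps_integral_def fps_mult_nth
  by (intro allI impI rat_cong_sum rat_cong_mult) auto

lemma fps_rat_cong_power:
  assumes "prime p" "fps_rat_cong p A B n" "fps_integral p A n" "fps_integral p B n"
  shows "fps_rat_cong p (A ^ k) (B ^ k) n"
  by (induction k) (use assms in \<open>simp_all add: fps_rat_cong_refl fps_rat_cong_mult fps_integral_power\<close>)

lemma fps_rat_cong_sym: "prime p \<Longrightarrow> fps_rat_cong p A B n \<Longrightarrow> fps_rat_cong p B A n"
  by (simp add: fps_rat_cong_def rat_cong_sym)

lemma fps_rat_cong_trans [trans]:
  "fps_rat_cong p A B n \<Longrightarrow> fps_rat_cong p B D n \<Longrightarrow> prime p \<Longrightarrow> fps_rat_cong p A D n"
  unfolding fps_rat_cong_def using rat_cong_trans by blast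

lemma fps_integral_log_quot: "prime p \<Longrightarrow> fps_integral p log_quot (p - 1)"
  unfolding fps_integral_def log_quot_def
proof (intro allI impI)
  fix j assume "prime p" "j < p - 1"
  hence "padic_integral p (- (1 / of_nat (Suc j)))"
    by (intro padic_integral_minus padic_integral_inverse_of_nat) (auto dest: dvd_imp_le)
  thus "padic_integral p (Abs_fps (\<lambda>n. - 1 / of_nat (Suc n)) $ j)" by simp
qed

text \<open>The constant term of \<open>log_quot\<close> is \<open>-1\<close>, so the recursion for
  the coefficients of its inverse involves no division.\<close>

lemma fps_integral_inverse_log_quot:
  assumes "prime p"
  shows "fps_integral p (inverse log_quot) (p - 1)"
proof -
  define U where "U = inverse log_quot"
  have "log_quot $ 0 = - 1" by (simp add: log_quot_def)
  hence UH: "log_quot * U = 1" by (simp add: U_def inverse_mult_eq_1')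
  have "padic_integral p (U $ n)" if "n < p - 1" for n
    using that
  proof (induction n rule: less_induct)
    case (less n)
    have "of_bool (n = 0) = (\<Sum>i=0..n. log_quot $ i * U $ (n - i))"
      unfolding fps_mult_nth[symmetric] UH by simp
    also have "\<dots> = - U $ n + (\<Sum>i\<in>{Suc 0..n}. log_quot $ i * U $ (n - i))"
      by (simp add: sum.atLeast_Suc_atMost \<open>log_quot $ 0 = - 1\<close>)
    finally have "U $ n = (\<Sum>i\<in>{Suc 0..n}. log_quot $ i * U $ (n - i)) - of_bool (n = 0)"
      by simp
    moreover have "padic_integral p \<dots>"
    proof (intro padic_integral_diff padic_integral_sum padic_integral_mult assms)
      show "padic_integral p (of_bool (n = 0))" using padic_integral_of_nat[OF assms, of "of_bool (n = 0)"] by simp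
      fix i assume "i \<in> {Suc 0..n}"
      thus "padic_integral p (log_quot $ i)" "padic_integral p (U $ (n - i))"
        using less fps_integral_log_quot[OF assms] by (auto simp: fps_integral_def)
    qed
    ultimately show ?case by simp
  qed
  thus ?thesis by (simp add: fps_integral_def U_def)
qed

text \<open>Modulo \<open>p\<close> and in degrees below \<open>p - 1\<close>,
  \<open>R ^ M = R ^ M * log_quot ^ k * U ^ k\<close> becomes \<open>R ^ (M + k) * U ^ k\<close>,
  and \<open>M + k = p * l\<close> makes the first factor \<open>(-1)^l\<close>. The coefficient of
  \<open>U ^ k\<close> is the Bernoulli value.\<close>

lemma coeff_reflect_g_poly_power_cong:
  assumes "prime p" "odd p" "2 \<le> k" "k < p - 1" "M + k = p * l"
  shows "rat_cong (of_int (coeff (reflect_poly (g_poly p) ^ M) k)) ((- 1) ^ l * (bernoulli k / fact k)) p"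
    and "padic_integral p (bernoulli k / fact k)"
proof -
  define h where "h = reflect_poly (g_poly p)"
  define R where "R = rat_fps h"
  define U where "U = inverse log_quot"
  note pr = assms(1)
  have U: "fps_integral p U (p - 1)" unfolding U_def by (rule fps_integral_inverse_log_quot) fact
  have Uk: "(U ^ k) $ k = bernoulli k / fact k"
    unfolding U_def using assms(3) by (rule log_quot_power_nth)
  show "padic_integral p (bernoulli k / fact k)"
    using fps_integral_power[OF pr U, of k] assms(4) Uk unfolding fps_integral_def by metis
  have R: "fps_integral p (R ^ n) (p - 1)" for n
    unfolding R_def by (intro fps_integral_power fps_integral_rat_fps pr)
  have UH: "log_quot * U = 1"
    unfolding U_def by (intro inverse_mult_eq_1') (simp add: log_quot_def)
  \<comment> \<open>In positive degree \<open>j\<close>, \<open>p * l\<close> divides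
    \<open>j\<close> times the coefficient, and \<open>p\<close> does not divide \<open>j\<close>.
    The constant term is \<open>(-1)^(p l) = (-1)^l\<close> for odd \<open>p\<close>.\<close>
  have Rpl: "fps_rat_cong p (R ^ (p * l)) ((- 1) ^ l) (p - 1)"
    unfolding fps_rat_cong_def
  proof (intro allI impI)
    fix j assume j: "j < p - 1"
    have h0: "coeff h 0 = - 1" using assms by (simp add: h_def degree_g_poly(1)) (metis One_nat_def degree_g_poly(2))
    have "[coeff (h ^ (p * l)) j = of_bool (j = 0) * (- 1) ^ l] (mod int p)"
    proof (cases j)
      case 0
      have "coeff (h ^ n) 0 = (- 1) ^ n" for n
        by (induction n) (simp_all add: coeff_mult_0 h0)
      moreover have "(- 1 :: int) ^ (p * l) = (- 1) ^ l"
        using assms(2) by (simp add: power_mult)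
      ultimately show ?thesis using 0 by simp
    next
      case (Suc d)
      then obtain m where "int j * coeff (h ^ (p * l)) j = int (p * l) * m"
        using dvd_coeff_power unfolding dvd_def by blast
      hence "int p dvd int j * coeff (h ^ (p * l)) j" by simp
      moreover have "\<not> int p dvd int j" using j Suc by (auto dest: zdvd_imp_le)
      ultimately have "int p dvd coeff (h ^ (p * l)) j"
        using pr by (simp add: prime_dvd_mult_iff)
      thus ?thesis using Suc by (simp add: cong_0_iff)
    qed
    from rat_cong_of_int[OF pr this]
    show "rat_cong (R ^ (p * l) $ j) ((- 1) ^ l $ j) p"
      unfolding R_def rat_fps_power[symmetric]
      by (cases "even l") (auto simp: of_bool_def)
  qed
  have RH: "fps_rat_cong p (R ^ k) (log_quot ^ k) (p - 1)"
    using R[of 1] assms unfolding R_def h_def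
    by (intro fps_rat_cong_power fps_integral_log_quot fps_integral_rat_fps)
       (auto simp: fps_rat_cong_def coeff_reflect_g_poly_cong)
  have "R ^ M = (R ^ M * log_quot ^ k) * U ^ k"
    using UH by (simp add: mult.assoc flip: power_mult_distrib)
  also have "fps_rat_cong p \<dots> (R ^ (M + k) * U ^ k) (p - 1)"
    unfolding power_add
    by (intro fps_rat_cong_mult fps_rat_cong_refl fps_rat_cong_sym[OF pr RH] fps_integral_power
          fps_integral_mult fps_integral_log_quot R U pr)
  also have "fps_rat_cong p (R ^ (M + k) * U ^ k) ((- 1) ^ l * U ^ k) (p - 1)"
    unfolding assms(5)
  proof (intro fps_rat_cong_mult fps_rat_cong_refl fps_integral_power Rpl U pr)
    have "fps_integral p (rat_fps (- 1)) (p - 1)" by (rule fps_integral_rat_fps) fact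
    moreover have "rat_fps (- 1) = - 1" by (rule fps_ext) (auto simp: coeff_1 fps_one_def)
    ultimately show "fps_integral p (- 1) (p - 1)" by simp
  qed
  finally have "fps_rat_cong p (R ^ M) ((- 1) ^ l * U ^ k) (p - 1)" using pr by blast
  hence "rat_cong (R ^ M $ k) (((- 1) ^ l * U ^ k) $ k) p"
    using assms(4) by (simp add: fps_rat_cong_def)
  moreover have "((- 1) ^ l * U ^ k) $ k = (- 1) ^ l * (bernoulli k / fact k)"
    by (cases "even l") (simp_all add: Uk)
  ultimately show "rat_cong (of_int (coeff (reflect_poly (g_poly p) ^ M) k)) ((- 1) ^ l * (bernoulli k / fact k)) p"
    by (simp add: R_def h_def flip: rat_fps_power)
qed

section \<open>Isolating the leading term of the expansion\<close>

lemma coeff_power_reflect: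
  assumes "prime p" "odd p" "N + d = (p - 1) * i"
  shows "coeff (g_poly p ^ i) N = coeff (reflect_poly (g_poly p) ^ i) d"
proof -
  have "g_poly p \<noteq> 0" using degree_g_poly(2)[OF assms(1,2)] by auto
  \<comment> \<open>The degree is \<open>(p - 1) * i\<close>, so index \<open>N\<close> from below
    is index \<open>d\<close> from the top.\<close>
  hence "degree (g_poly p ^ i) = N + d"
    using assms(3) degree_g_poly(1)[OF assms(1,2)] by (simp add: degree_power_eq mult.commute)
  thus ?thesis by (simp add: coeff_reflect_poly flip: reflect_poly_power)
qed

text \<open>For \<open>q = 1\<close> the number is \<open>p + (k - 1)\<close> with
  \<open>0 < k - 1 < p\<close>. For \<open>q \<ge> 2\<close> it is too small: it is below
  \<open>p (q + 1)\<close>, which is at most \<open>p ^ q\<close>. It bounds the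
  \<open>p\<close>-part of the denominators in the tail of the expansion.\<close>

lemma prime_power_not_dvd_linear:
  fixes p k q :: nat
  assumes "p \<ge> 3" "2 \<le> k" "k < p - 1" "q > 0"
  shows "\<not> p ^ q dvd k + (p - 1) * q"
proof (cases "q = 1")
  case True
  have "k + (p - 1) = p + (k - 1)" using assms by simp
  moreover have "\<not> p dvd k - 1" using assms by (auto dest: dvd_imp_le)
  ultimately show ?thesis using True by (simp add: dvd_add_right_iff)
next
  case False
  then obtain s where q: "q = Suc (Suc s)" using assms(4) by (metis One_nat_def gr0_implies_Suc neq0_conv)
  have "q + 1 \<le> 3 ^ Suc s" unfolding q by (induction s) auto
  also have "\<dots> \<le> p ^ Suc s" using assms(1) by (intro power_mono) auto
  finally have "p * (q + 1) \<le> p * p ^ Suc s" by (rule mult_le_mono2)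
  hence "p * (q + 1) \<le> p ^ q" unfolding q by simp
  moreover have "(p - 1) * q + q = p * q" using assms(1) by (simp add: algebra_simps)
  ultimately have "k + (p - 1) * q < p ^ q" using assms by (simp add: algebra_simps)
  thus ?thesis using assms(2) by (auto dest!: dvd_imp_le)
qed

text \<open>In the expansion the terms with \<open>i \<le> e\<close> vanish by degree,
  \<open>i = e + 1\<close> is the term subtracted, and each later term is divisible by
  \<open>p ^ Suc e\<close> even after accounting for its denominator \<open>i\<close>.\<close>

lemma C_leading_term:
  assumes "prime p" "odd p" "N > 0" "2 \<le> k" "k < p - 1" "N + k = (p - 1) * Suc e"
  shows "padic_integral p ((of_int (C p N 0) / of_nat N
           - of_nat p ^ e / of_nat (Suc e) * of_int (coeff (reflect_poly (g_poly p) ^ Suc e) k))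
         / of_nat p ^ Suc e)"
proof -
  define h where "h = reflect_poly (g_poly p)"
  define t :: "nat \<Rightarrow> rat" where
    "t i = of_nat p ^ (i - 1) / of_nat i * of_int (coeff (g_poly p ^ i) N)" for i
  note pr = assms(1)
  have p: "p \<ge> 3" using assms(2) prime_ge_2_nat[OF pr] by (cases "p = 2") auto
  \<comment> \<open>The purpose is \<open>Suc e \<le> N\<close>: the leading index lies within the
    range of summation.\<close>
  have "p - 1 = p - 2 + 1" using p by simp
  hence "(p - 2) * Suc e + Suc e = N + k"
    unfolding assms(6) by (simp only: add_mult_distrib mult_1)
  moreover have "k \<le> (p - 2) * Suc e" using assms(5) by simp
  ultimately have eN: "Suc e \<le> N" by linarith
  have te: "t (Suc e) = of_nat p ^ e / of_nat (Suc e) * of_int (coeff (h ^ Suc e) k)"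
    unfolding t_def h_def using coeff_power_reflect[OF assms(1,2,6)] by simp
  have "of_int (C p N 0) / of_nat N = (\<Sum>i=1..N. t i)"
    unfolding t_def by (rule C_expansion) fact+
  also have "\<dots> = t (Suc e) + (\<Sum>i\<in>{1..N}-{Suc e}. t i)"
    using eN by (intro sum.remove) auto
  finally have "(of_int (C p N 0) / of_nat N - t (Suc e)) / of_nat p ^ Suc e
      = (\<Sum>i\<in>{1..N}-{Suc e}. t i / of_nat p ^ Suc e)"
    by (simp add: sum_divide_distrib)
  moreover have "padic_integral p \<dots>"
  proof (intro padic_integral_sum pr)
    fix i assume i: "i \<in> {1..N} - {Suc e}"
    show "padic_integral p (t i / of_nat p ^ Suc e)"
    proof (cases "i \<le> e")
      case True
      have "degree (g_poly p ^ i) \<le> (p - 1) * i"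
        using degree_power_le[of "g_poly p" i] degree_g_poly(1)[OF assms(1,2)] by simp
      also have "\<dots> \<le> (p - 1) * e" using True by simp
      also have "\<dots> < N" using assms(5,6) by simp
      finally show ?thesis
        using padic_integral_of_int[OF pr, of 0] by (simp add: t_def coeff_eq_0)
    next
      case False
      define q where "q = i - Suc e"
      have q: "i = Suc e + q" "q > 0" using False i by (auto simp: q_def)
      define d where "d = k + (p - 1) * q"
      have d: "d > 0" using assms(4) by (simp add: d_def)
      have "N + d = (p - 1) * Suc e + (p - 1) * q" using assms(6) by (simp add: d_def)
      hence "N + d = (p - 1) * i" unfolding q(1) by (simp only: add_mult_distrib2)
      hence coeff: "coeff (g_poly p ^ i) N = coeff (h ^ i) d"
        unfolding h_def by (rule coeff_power_reflect[OF assms(1,2)])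
      \<comment> \<open>The denominator \<open>i = e + 1 + q\<close> is replaced by
        \<open>d = k + (p - 1) * q\<close>, whose \<open>p\<close>-part is covered by the spare
        factor \<open>p ^ (q - 1)\<close>.\<close>
      obtain m where m: "int d * coeff (h ^ i) d = int i * m"
        using dvd_coeff_power[of i "d - 1" h] d by (auto elim: dvdE)
      have "(of_nat d * of_int (coeff (h ^ i) d) :: rat) = of_nat i * of_int m"
        using arg_cong[OF m, of "of_int :: int \<Rightarrow> rat"] by simp
      hence "(of_int (coeff (h ^ i) d) / of_nat i :: rat) = of_int m / of_nat d"
        using d i by (simp add: field_simps)
      moreover have "i - 1 = Suc e + (q - 1)" using q by simp
      hence "(of_nat p ^ (i - 1) :: rat) = of_nat p ^ Suc e * of_nat p ^ (q - 1)"
        by (simp only: power_add)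
      hence "t i / of_nat p ^ Suc e = of_nat p ^ (q - 1) * (of_int (coeff (h ^ i) d) / of_nat i)"
        using p by (simp add: t_def coeff del: power_Suc)
      ultimately have "t i / of_nat p ^ Suc e = of_int m * (of_nat p ^ (q - 1) / of_nat d)"
        by (simp del: power_Suc)
      moreover have "padic_integral p (of_int m * (of_nat p ^ (q - 1) / of_nat d))"
        using prime_power_not_dvd_linear[OF p assms(4,5) q(2)] q(2)
        by (intro padic_integral_mult padic_integral_of_int padic_integral_power_divide pr)
           (simp add: d_def)
      ultimately show ?thesis by simp
    qed
  qed
  ultimately show ?thesis by (simp add: te h_def)
qed

text \<open>Multiplying by \<open>binom(p-1, r)\<close>, which is \<open>(-1)^r = 1\<close> modulo
  \<open>p\<close>, gives \<open>(p-1)!\<close>; then Wilson's theorem applies.\<close>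

lemma fact_mult_fact_cong:
  assumes "prime p" "r < p" "even r"
  shows "[fact r * fact (p - 1 - r) = - 1 :: int] (mod int p)"
proof -
  have "fact r * fact (p - 1 - r) * int ((p - 1) choose r) = fact (p - 1)"
    using assms(2) binomial_fact_lemma[of r "p - 1"]
    by (metis Suc_diff_1 assms(1) less_Suc_eq_le of_nat_fact of_nat_mult prime_gt_0_nat)
  moreover have "[fact r * fact (p - 1 - r) * int ((p - 1) choose r) = fact r * fact (p - 1 - r) * (- 1) ^ r] (mod int p)"
    using assms by (intro cong_mult cong_refl binomial_pred_prime_cong)
  ultimately show ?thesis
    using wilson_theorem[OF assms(1)] assms(3) by (simp add: cong_def)
qed

section \<open>Symmetry of the alternating sums\<close>

lemma C_reflect:
  assumes "odd N" "[int N = - 1] (mod int p)"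
  shows "C p N (- 1) = - C p N 0"
proof -
  \<comment> \<open>Replacing \<open>k\<close> by \<open>N - k\<close> exchanges the residues
    \<open>0\<close> and \<open>-1\<close> and keeps the binomial coefficient; the sign flips
    because \<open>N\<close> is odd.\<close>
  have "C p N (- 1) = (\<Sum>k\<le>N. of_bool ([int (N - k) = - 1] (mod int p)) * (of_nat (N choose (N - k)) * (- 1) ^ (N - k)))"
    unfolding C_eq_sum by (rule sum.reindex_bij_witness[of _ "\<lambda>k. N - k" "\<lambda>k. N - k"]) auto
  also have "\<dots> = - C p N 0"
    unfolding C_eq_sum sum_negf[symmetric]
  proof (intro sum.cong refl)
    fix k assume k: "k \<in> {..N}"
    have "int p dvd int N + 1" using assms(2) by (simp add: cong_iff_dvd_diff)
    hence "int p dvd (int N + 1) - int k \<longleftrightarrow> int p dvd int k"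
      by (metis dvd_diff_right_iff dvd_diff_left_iff)
    hence "[int (N - k) = - 1] (mod int p) \<longleftrightarrow> [int k = 0] (mod int p)"
      using k by (simp add: cong_iff_dvd_diff of_nat_diff algebra_simps)
    moreover have "N choose (N - k) = N choose k"
      using k by (intro binomial_symmetric[symmetric]) auto
    moreover have "(- 1 :: int) ^ (N - k) = - ((- 1) ^ k)"
      using k assms(1) by (simp add: minus_one_power_iff)
    ultimately show "of_bool ([int (N - k) = - 1] (mod int p)) * (of_nat (N choose (N - k)) * (- 1) ^ (N - k)) =
        - (of_bool ([int k = 0] (mod int p)) * (int (N choose k) * (- 1) ^ k))"
      by simp
  qed
  finally show ?thesis .
qed

text \<open>The indices congruent to \<open>-1\<close> up to \<open>p n - 1\<close> are the numbers
  \<open>p k - 1\<close>, and \<open>(-1)^(p k - 1) = - (-1)^k\<close> for odd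
  \<open>p\<close>.\<close>

lemma C_minus_one_eq_sum:
  assumes "odd p" "n > 0"
  shows "C p (p * n - 1) (- 1) = - (\<Sum>k=1..n. of_nat ((p * n - 1) choose (p * k - 1)) * (- 1) ^ k)"
proof -
  have p: "p > 0" using assms(1) by (cases p) auto
  have "C p (p * n - 1) (- 1) = (\<Sum>k=1..n. of_nat ((p * n - 1) choose (p * k - 1)) * (- 1) ^ (p * k - 1))"
    unfolding C_def
  proof (rule sum.reindex_bij_witness[of _ "\<lambda>k. p * k - 1" "\<lambda>j. Suc j div p"])
    fix j assume "j \<in> {k. k \<le> p * n - 1 \<and> [int k = - 1] (mod int p)}"
    hence j: "j \<le> p * n - 1" "int p dvd int (Suc j)"
      by (auto simp: cong_iff_dvd_diff algebra_simps)
    then obtain t where t: "Suc j = p * t" by (metis dvd_def of_nat_dvd_iff)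
    have "p * n > 0" using p assms(2) by simp
    hence "p * t \<le> p * n" using j(1) t by linarith
    hence tn: "t \<le> n" "t > 0" using p t by (auto intro: Nat.gr0I)
    show "p * (Suc j div p) - 1 = j" using t p by simp
    show "Suc j div p \<in> {1..n}" using t p tn by simp
    show "of_nat (p * n - 1 choose (p * (Suc j div p) - 1)) * (- 1) ^ (p * (Suc j div p) - 1) =
         int (p * n - 1 choose j) * (- 1) ^ j"
      using \<open>p * (Suc j div p) - 1 = j\<close> by simp
  next
    fix k assume k: "k \<in> {1..n}"
    hence pk: "p * k > 0" using p by simp
    thus "Suc (p * k - 1) div p = k" using p by simp
    have "p * k \<le> p * n" using k by simp
    thus "p * k - 1 \<in> {k. k \<le> p * n - 1 \<and> [int k = - 1] (mod int p)}"
      using pk by (auto simp: cong_iff_dvd_diff of_nat_diff intro: diff_le_mono)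
  qed
  also have "\<dots> = (\<Sum>k=1..n. - (of_nat ((p * n - 1) choose (p * k - 1)) * (- 1) ^ k))"
  proof (intro sum.cong refl)
    fix k assume "k \<in> {1..n}"
    hence "p * k > 0" using p by simp
    hence "(- 1 :: int) ^ (p * k - 1) = - ((- 1) ^ k)"
      using assms(1) by (simp add: minus_one_power_iff)
    thus "of_nat ((p * n - 1) choose (p * k - 1)) * (- 1) ^ (p * k - 1) = - (of_nat ((p * n - 1) choose (p * k - 1)) * (- 1 :: int) ^ k)"
      by simp
  qed
  finally show ?thesis by (simp add: sum_negf)
qed

text \<open>One Pascal step from \<open>p n - 1\<close> to \<open>p n\<close> gives a difference of
  the sums for residues \<open>0\<close> and \<open>-1\<close>. Since \<open>p n - 1\<close> is odd,
  these are negatives of each other.\<close>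

lemma C_prime_multiple:
  assumes "odd p" "n > 0" "even n"
  shows "C p (p * n) 0 = 2 * C p (p * n - 1) 0"
    and "C p (p * n) 0 = 2 * (\<Sum>k=1..n. of_nat ((p * n - 1) choose (p * k - 1)) * (- 1) ^ k)"
proof -
  have "p * n > 0" using assms by (auto intro: Nat.gr0I)
  hence N: "p * n = Suc (p * n - 1)" by simp
  have "C p (p * n - 1) (- 1) = - C p (p * n - 1) 0"
    using \<open>p * n > 0\<close> assms(3) by (intro C_reflect) (auto simp: cong_iff_dvd_diff of_nat_diff)
  moreover have "C p (p * n) 0 = C p (p * n - 1) 0 - C p (p * n - 1) (- 1)"
    by (subst N, subst C_Suc) simp
  ultimately show "C p (p * n) 0 = 2 * C p (p * n - 1) 0"
    "C p (p * n) 0 = 2 * (\<Sum>k=1..n. of_nat ((p * n - 1) choose (p * k - 1)) * (- 1) ^ k)"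
    using C_minus_one_eq_sum[OF assms(1,2)] by simp_all
qed

section \<open>Floor exponents and error terms\<close>

lemma exponent_floor:
  fixes p n Q r j :: nat
  assumes "p > 0" "n = (p - 1) * Q + r" "j \<le> r" "0 < j" "r < p - 1"
  shows "(int (p * n) - int j) div (int p - 1) = int (n + Q)"
    and "(int n - int j) div (int p - 1) = int Q"
proof -
  obtain s where s: "p = Suc s" using assms(1) by (cases p) auto
  show "(int n - int j) div (int p - 1) = int Q"
    by (rule int_div_pos_eq[where r = "int (r - j)"])
       (use assms s in \<open>auto simp: of_nat_diff\<close>)
  \<comment> \<open>Here \<open>p n = (p - 1) (n + Q) + r\<close>, and \<open>r - j\<close> is still
    a valid remainder.\<close>
  show "(int (p * n) - int j) div (int p - 1) = int (n + Q)"
    by (rule int_div_pos_eq[where r = "int (r - j)"])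
       (use assms s in \<open>auto simp: of_nat_diff algebra_simps\<close>)
qed

text \<open>Up to sign and \<open>w\<close>, the quotient is \<open>p ^ (b - 2 e - 1)\<close> times
  \<open>p ^ (e - 1) / n\<close>. The latter is integral because
  \<open>n < p ^ n \<le> p ^ e\<close> prevents \<open>p ^ e\<close> from dividing
  \<open>n\<close>.\<close>

lemma padic_integral_quotient:
  assumes "prime p" "e \<ge> n" "n > 0" "b > 2 * e"
  shows "padic_integral p (of_nat p ^ b * of_int w / (of_nat (p * n) * (- of_nat p) ^ e) / of_nat p)"
proof -
  have p: "p > 1" using assms(1) prime_gt_1_nat by blast
  have "n < 2 ^ n" by (rule less_exp)
  also have "\<dots> \<le> p ^ n" using p by (intro power_mono) auto
  also have "\<dots> \<le> p ^ e" using p assms(2) by (intro power_increasing) auto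
  finally have "\<not> p ^ Suc (e - 1) dvd n" using assms(2,3) by (auto dest: dvd_imp_le)
  hence int: "padic_integral p (of_nat p ^ (e - 1) / of_nat n)"
    by (intro padic_integral_power_divide assms)
  have "b = (b - 2 * e - 1) + (e - 1) + (e + 2)" using assms by simp
  hence "(of_nat p ^ b :: rat) = of_nat p ^ (b - 2 * e - 1) * of_nat p ^ (e - 1) * of_nat p ^ (e + 2)"
    by (metis power_add)
  moreover have "(- of_nat p :: rat) ^ e = (- 1) ^ e * of_nat p ^ e" by (rule power_minus)
  ultimately have "of_nat p ^ b * of_int w / (of_nat (p * n) * (- of_nat p) ^ e) / of_nat p =
      of_int ((- 1) ^ e * w) * of_nat p ^ (b - 2 * e - 1) * (of_nat p ^ (e - 1) / of_nat n :: rat)"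
    using p assms(3) by (cases "even e") (simp_all add: field_simps power2_eq_square)
  moreover have "padic_integral p \<dots>"
    by (intro padic_integral_mult padic_integral_power padic_integral_of_int padic_integral_of_nat int assms)
  ultimately show ?thesis by simp
qed

lemma pos_residue_eq_mod:
  assumes "\<not> (p - 1) dvd n"
  shows "pos_residue p n = n mod (p - 1)"
  unfolding pos_residue_def
proof (rule Least_equality)
  show "0 < n mod (p - 1) \<and> [n mod (p - 1) = n] (mod (p - 1))"
    using assms by (auto simp: dvd_eq_mod_eq_0)
  fix y assume "0 < y \<and> [y = n] (mod (p - 1))"
  thus "n mod (p - 1) \<le> y" by (metis cong_def mod_less_eq_dividend)
qed

text \<open>With \<open>e = n + Q\<close> and \<open>k = p - 1 - r\<close> the leading term has
  exponent \<open>e + 1 = p (Q + 1) - k\<close>, so it reduces to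
  \<open>- bernoulli k / (k! (e + 1))\<close>. Wilson's theorem and \<open>e + 1 = r + 1\<close>
  modulo \<open>p\<close> rewrite this in terms of \<open>r\<close>.\<close>

lemma F_cong:
  fixes p n Q r :: nat
  assumes "prime p" "odd p" "n > 0" "even n" "n = (p - 1) * Q + r" "0 < r" "r < p - 1"
  shows "rat_cong (of_int (C p (p * n) 0) / of_nat (p * n) / (- of_nat p) ^ (n + Q))
           (fact r / of_nat (r + 1) * bernoulli (p - 1 - r)) p"
proof -
  define e where "e = n + Q"
  define k where "k = p - 1 - r"
  define l where "l = Suc Q"
  define Y where "Y = coeff (reflect_poly (g_poly p) ^ Suc e) k"
  define \<beta> where "\<beta> = bernoulli k / fact k"
  note pr = assms(1)
  have p: "p > 0" using pr prime_gt_0_nat by blast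
  have even_r: "even r" using assms(2,4,5) by auto
  have even_k: "even k" using even_r assms(2,7) by (auto simp: k_def)
  have "k > 0" using assms(7) by (simp add: k_def)
  \<comment> \<open>Parity excludes \<open>k = 1\<close>, as the evaluation through Lagrange
    inversion requires.\<close>
  hence "2 \<le> k" using even_k by (auto elim!: evenE)
  moreover have "k < p - 1" using assms(6,7) by (simp add: k_def)
  ultimately have k: "2 \<le> k" "k < p - 1" .
  have pk: "p = k + r + 1" using assms(7) by (simp add: k_def)
  have N: "p * n + k = (p - 1) * Suc e"
  proof -
    have "n = (k + r) * Q + r" using assms(5) pk by simp
    thus ?thesis unfolding pk e_def by (simp add: algebra_simps)
  qed
  have M: "Suc e + k = p * l"
  proof -
    have "n = (k + r) * Q + r" using assms(5) pk by simp
    thus ?thesis unfolding pk e_def l_def by (simp add: algebra_simps)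
  qed
  \<comment> \<open>\<open>e + l = n + 2 Q + 1\<close> is odd; this produces the overall minus
    sign.\<close>
  have parity: "even (e + l) \<longleftrightarrow> False" using assms(4) by (simp add: e_def l_def)
  have Ycong: "rat_cong (of_int Y) ((- 1) ^ l * \<beta>) p" and \<beta>: "padic_integral p \<beta>"
    unfolding Y_def \<beta>_def using coeff_reflect_g_poly_power_cong[OF pr assms(2) k M] by auto
  have ndvd: "\<not> p dvd Suc e"
  proof
    assume "p dvd Suc e"
    hence "p dvd k" using M by (metis dvd_add_right_iff dvd_triv_left)
    thus False using k by (auto dest: dvd_imp_le)
  qed
  define A where "A = (of_int (C p (p * n) 0) / of_nat (p * n) :: rat)"
  define z where "z = (A - of_nat p ^ e / of_nat (Suc e) * of_int Y) / of_nat p ^ Suc e"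
  have z: "padic_integral p z"
    unfolding z_def A_def Y_def using p assms(3) by (intro C_leading_term[OF pr assms(2) _ k N]) simp
  have "A = of_nat p ^ e * (of_int Y / of_nat (Suc e) + of_nat p * z)"
    using p by (simp add: z_def field_simps del: of_nat_Suc)
  hence "A / (- of_nat p) ^ e = (- 1) ^ e * (of_int Y / of_nat (Suc e) + of_nat p * z)"
    using p by (cases "even e") (simp_all add: power_minus_odd)
  hence "(A / (- of_nat p) ^ e - (- 1) ^ e * (1 / of_nat (Suc e)) * of_int Y) / of_nat p = (- 1) ^ e * z"
    using p by (simp add: algebra_simps del: of_nat_Suc)
  moreover have sgn: "padic_integral p ((- 1) ^ e)"
    using padic_integral_of_int[OF pr, of "(- 1) ^ e"] by simp
  ultimately have "rat_cong (A / (- of_nat p) ^ e) ((- 1) ^ e * (1 / of_nat (Suc e)) * of_int Y) p"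
    using z pr by (simp add: rat_cong_def padic_integral_mult)
  moreover have "rat_cong ((- 1) ^ e * (1 / of_nat (Suc e)) * of_int Y)
      ((- 1) ^ e * (1 / of_nat (Suc e)) * ((- 1) ^ l * \<beta>)) p"
    by (intro rat_cong_mult rat_cong_refl Ycong padic_integral_mult sgn padic_integral_of_int
          padic_integral_inverse_of_nat ndvd pr)
  moreover have "(- 1) ^ e * (1 / of_nat (Suc e)) * ((- 1) ^ l * \<beta>) = - \<beta> / of_nat (Suc e)"
  proof -
    have "(- 1 :: rat) ^ e * (- 1) ^ l = - 1" using parity by (simp flip: power_add)
    thus ?thesis by (simp del: of_nat_Suc) (simp add: algebra_simps del: of_nat_Suc)
  qed
  ultimately have 1: "rat_cong (A / (- of_nat p) ^ e) (- \<beta> / of_nat (Suc e)) p"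
    using rat_cong_trans[OF pr] by metis
  have 2: "rat_cong (- \<beta> / of_nat (Suc e)) (fact r / of_nat (r + 1) * bernoulli k) p"
  proof -
    have "int (Suc e) = int p * int Q + int (r + 1)"
      using M unfolding l_def pk by (simp add: algebra_simps flip: of_nat_add of_nat_mult)
    hence er: "[int (Suc e) = int (r + 1)] (mod int p)"
      by (simp add: cong_iff_dvd_diff)
    have "[fact r * fact k = - 1 :: int] (mod int p)"
      unfolding k_def using assms(7) even_r by (intro fact_mult_fact_cong pr) auto
    \<comment> \<open>This integer is, up to the factor \<open>- \<beta>\<close>, the numerator of
      the difference over the common denominator \<open>(e + 1) (r + 1)\<close>.\<close>
    from cong_add[OF cong_refl[of "int (r + 1)"] cong_mult[OF er this]]
    have "[int (r + 1) + int (Suc e) * (fact r * fact k) = 0] (mod int p)" by simp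
    then obtain t where t: "int (r + 1) + int (Suc e) * (fact r * fact k) = int p * t"
      by (auto simp: cong_0_iff)
    have rt: "(of_nat (r + 1) + of_nat (Suc e) * (fact r * fact k) :: rat) = of_nat p * of_int t"
      using arg_cong[OF t, of "of_int :: int \<Rightarrow> rat"] by simp
    have "- \<beta> / of_nat (Suc e) - fact r / of_nat (r + 1) * bernoulli k =
        - \<beta> * (of_nat (r + 1) + of_nat (Suc e) * (fact r * fact k)) * (1 / of_nat (Suc e)) * (1 / of_nat (r + 1))"
      unfolding \<beta>_def by (simp add: divide_simps del: of_nat_Suc of_nat_add) (simp add: algebra_simps del: of_nat_Suc of_nat_add)
    also have "\<dots> / of_nat p = - \<beta> * of_int t * (1 / of_nat (Suc e)) * (1 / of_nat (r + 1))"
      unfolding rt using p by simp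
    finally have "(- \<beta> / of_nat (Suc e) - fact r / of_nat (r + 1) * bernoulli k) / of_nat p = \<dots>" .
    moreover have "\<not> p dvd r + 1" using assms(7) by (auto dest: dvd_imp_le)
    hence "padic_integral p (- \<beta> * of_int t * (1 / of_nat (Suc e)) * (1 / of_nat (r + 1)))"
      by (intro padic_integral_mult padic_integral_minus padic_integral_of_int
            padic_integral_inverse_of_nat \<beta> ndvd pr)
    ultimately show ?thesis by (simp add: rat_cong_def)
  qed
  show ?thesis
    using rat_cong_trans[OF pr 1 2] by (simp add: A_def e_def k_def)
qed

theorem theorem1p2:
  fixes p n :: nat
  assumes "prime p" and "odd p"
    and "n > 0" and "even n" and "\<not> (p - 1) dvd n"
  defines "n' \<equiv> pos_residue p n"
  defines "T \<equiv> fact n' / of_nat (n' + 1) * bernoulli (p - 1 - n')"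
  shows
    "2 * (\<Sum>k = 1..n. of_nat ((p * n - 1) choose (p * k - 1)) * (- 1) ^ k)
       / ((- of_nat p) powi ((int n - 2) div (int p - 1)) * of_nat p ^ (n + 1) * of_nat n)
     = F p (p * n) 0 / of_nat (p * n)
   \<and> rat_cong (F p (p * n) 0 / of_nat (p * n)) T p
   \<and> (\<forall>b m :: nat. b > 0 \<longrightarrow> m > 0 \<longrightarrow> int b > 2 * ((int (p * n) - 1) div (int p - 1)) \<longrightarrow>
        rat_cong
          (2 / of_nat (p * n) *
            (fact (p * n - 1) * of_nat (Stirling (m * totient (p ^ b)) (p * n - 1))
              / (- of_nat p) powi ((int (p * n) - 2) div (int p - 1))))
          (- (fact (p * n - 1) * of_nat (Stirling (m * totient (p ^ b)) (p * n))
              / (- of_nat p) powi ((int (p * n) - 1) div (int p - 1))))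
          p
      \<and> rat_cong
          (- (fact (p * n - 1) * of_nat (Stirling (m * totient (p ^ b)) (p * n))
              / (- of_nat p) powi ((int (p * n) - 1) div (int p - 1))))
          T p)"
proof -
  note pr = assms(1)
  define Q where "Q = n div (p - 1)"
  define e where "e = n + Q"
  define A where "A = (of_int (C p (p * n) 0) / of_nat (p * n) / (- of_nat p) ^ e :: rat)"
  have p: "p > 0" using pr prime_gt_0_nat by blast
  have n': "n' = n mod (p - 1)" unfolding n'_def using assms(5) by (rule pos_residue_eq_mod)
  have nQ: "n = (p - 1) * Q + n'" by (simp add: Q_def n')
  have "p \<noteq> 1" using pr by auto
  hence n'_less: "n' < p - 1" using p by (simp add: n')
  have "even ((p - 1) * Q + n')" using assms(4) unfolding nQ[symmetric] .
  hence "even n'" using assms(2) by simp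
  moreover have "0 < n'" using assms(5) by (simp add: n' mod_greater_zero_iff_not_dvd)
  \<comment> \<open>With a remainder of at least \<open>2\<close>, subtracting \<open>1\<close> or
    \<open>2\<close> gives the same floor.\<close>
  ultimately have n'_ge: "2 \<le> n'" by (auto elim!: evenE)
  have fl1: "(int (p * n) - 1) div (int p - 1) = int e"
    using exponent_floor(1)[OF p nQ, of 1] n'_ge n'_less by (simp add: e_def)
  have fl2: "(int (p * n) - 2) div (int p - 1) = int e" "(int n - 2) div (int p - 1) = int Q"
    using exponent_floor[OF p nQ, of 2] n'_ge n'_less by (simp_all add: e_def)
  have pn: "p * n > 0" using p assms(3) by simp
  have FA: "F p (p * n) 0 / of_nat (p * n) = A"
    unfolding F_def A_def fl1 using pn by (simp add: power_int_minus divide_simps)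
  have AT: "rat_cong A T p"
    unfolding A_def e_def T_def using F_cong[OF assms(1-4) nQ \<open>0 < n'\<close> n'_less] .
  have C_twice: "(of_int (C p (p * n) 0) :: rat) = 2 * of_int (C p (p * n - 1) 0)"
    using C_prime_multiple(1)[OF assms(2-4)] by simp
  have "(of_int (C p (p * n) 0) :: rat) =
      2 * (\<Sum>k = 1..n. of_nat ((p * n - 1) choose (p * k - 1)) * (- 1) ^ k)"
    unfolding C_prime_multiple(2)[OF assms(2-4)] by simp
  \<comment> \<open>For even \<open>n\<close> the part \<open>(-p)^n\<close> is \<open>p^n\<close>,
    matching the denominator of the first expression.\<close>
  moreover have "(- of_nat p :: rat) ^ e = (- of_nat p) ^ Q * of_nat p ^ n"
    using assms(4) by (simp add: e_def power_add)
  ultimately have eq: "2 * (\<Sum>k = 1..n. of_nat ((p * n - 1) choose (p * k - 1)) * (- 1) ^ k)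
       / ((- of_nat p) powi int Q * of_nat p ^ (n + 1) * of_nat n) = A"
    unfolding A_def by (simp add: field_simps)
  \<comment> \<open>Both Stirling expressions are compared with \<open>A\<close>: each differs from
    it by an integer multiple of \<open>p ^ b / (p n (-p)^e)\<close>, and \<open>b > 2 e\<close>
    makes this divisible by \<open>p\<close>.\<close>
  have part2: "rat_cong X3 A p \<and> rat_cong X1 A p"
    if bm: "b > 0" "m > 0" and b: "int b > 2 * int e"
      and X1: "X1 = 2 / of_nat (p * n) *
            (fact (p * n - 1) * of_nat (Stirling (m * totient (p ^ b)) (p * n - 1)) / (- of_nat p) powi int e)"
      and X3: "X3 = - (fact (p * n - 1) * of_nat (Stirling (m * totient (p ^ b)) (p * n)) / (- of_nat p) powi int e)"
    for b m :: nat and X1 X3 :: rat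
  proof -
    have int: "padic_integral p (of_nat p ^ b * of_int w / (of_nat (p * n) * (- of_nat p) ^ e) / of_nat p)" for w
      using b by (intro padic_integral_quotient pr assms(3)) (auto simp: e_def)
    obtain w where w: "fact (p * n) * int (Stirling (m * totient (p ^ b)) (p * n)) + C p (p * n) 0 = int p ^ b * w"
      using Stirling_totient_cong[OF pr bm pn] assms(4) by (auto simp: cong_iff_dvd_diff)
    \<comment> \<open>The sign \<open>(-1)^N\<close> is \<open>1\<close> for \<open>N = p n\<close>
      but \<open>-1\<close> for \<open>N = p n - 1\<close>, hence the opposite signs of the two
      Stirling expressions.\<close>
    have odd: "odd (p * n - 1)" using pn assms(4) by simp
    hence pn1: "p * n - 1 > 0" by (rule odd_pos)
    have "int p ^ b dvd C p (p * n - 1) 0 - fact (p * n - 1) * int (Stirling (m * totient (p ^ b)) (p * n - 1))"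
      using Stirling_totient_cong[OF pr bm pn1] odd by (auto simp: cong_iff_dvd_diff)
    then obtain v where "C p (p * n - 1) 0 - fact (p * n - 1) * int (Stirling (m * totient (p ^ b)) (p * n - 1)) = int p ^ b * v"
      by (rule dvdE)
    hence v: "fact (p * n - 1) * int (Stirling (m * totient (p ^ b)) (p * n - 1)) - C p (p * n - 1) 0 = int p ^ b * - v"
      by simp
    define D where "D = (of_nat (p * n) * (- of_nat p) ^ e :: rat)"
    have "X3 - A = - ((fact (p * n) * of_nat (Stirling (m * totient (p ^ b)) (p * n)) + of_int (C p (p * n) 0)) / D)"
    proof -
      have "(fact (p * n) :: rat) = of_nat (p * n) * fact (p * n - 1)"
        using pn by (simp add: fact_reduce)
      thus ?thesis using pn by (simp add: X3 A_def D_def field_simps)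
    qed
    also have "fact (p * n) * of_nat (Stirling (m * totient (p ^ b)) (p * n)) + of_int (C p (p * n) 0) = (of_nat p ^ b * of_int w :: rat)"
      using arg_cong[OF w, of "of_int :: int \<Rightarrow> rat"] by simp
    finally have "rat_cong X3 A p"
      using padic_integral_minus[OF pr int[of w]] by (simp add: rat_cong_def D_def)
    moreover have "rat_cong X1 A p"
    proof -
      have "X1 - A = 2 * (fact (p * n - 1) * of_nat (Stirling (m * totient (p ^ b)) (p * n - 1)) - of_int (C p (p * n - 1) 0)) / D"
        using pn unfolding X1 A_def D_def C_twice by (simp add: field_simps)
      also have "fact (p * n - 1) * of_nat (Stirling (m * totient (p ^ b)) (p * n - 1)) - of_int (C p (p * n - 1) 0) = (of_nat p ^ b * of_int (- v) :: rat)"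
        using arg_cong[OF v, of "of_int :: int \<Rightarrow> rat"] by simp
      finally have "X1 - A = of_nat p ^ b * of_int (2 * - v) / D" by simp
      thus ?thesis using int[of "2 * - v"] by (simp only: rat_cong_def D_def)
    qed
    ultimately show ?thesis by blast
  qed
  show ?thesis
    unfolding FA fl1 fl2 eq
  proof (intro conjI allI impI AT refl)
    fix b m :: nat
    assume "b > 0" "m > 0" "int b > 2 * int e"
    note * = part2[OF this refl refl]
    show "rat_cong
          (2 / of_nat (p * n) *
            (fact (p * n - 1) * of_nat (Stirling (m * totient (p ^ b)) (p * n - 1))
              / (- of_nat p) powi int e))
          (- (fact (p * n - 1) * of_nat (Stirling (m * totient (p ^ b)) (p * n))
              / (- of_nat p) powi int e)) p"
      using * rat_cong_trans[OF pr] rat_cong_sym[OF pr] by blast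
    show "rat_cong
          (- (fact (p * n - 1) * of_nat (Stirling (m * totient (p ^ b)) (p * n))
              / (- of_nat p) powi int e)) T p"
      using * rat_cong_trans[OF pr _ AT] by blast
  qed
qed

end
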